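(* Let $\mathcal{A}$ be a finite structure with domain $A$, $|A|=n$, and let $\mathbf{\Omega}=(\Omega_m)_{m\geq1}$ be a projective sequence of sets of adversaries, none of which is degenerate. The following are equivalent. (i) For every $m\geq1$ and every pH-sentence $\psi$ with $m$ universal variables, $\mathcal{A}\models\psi_{\upharpoonright\Omega_m}$ implies $\mathcal{A}\models\psi$. (ii) For every $m\geq1$ and every $\Pi_2$-pH-sentence $\psi$ with $m$ universal variables, $\mathcal{A}\models\psi_{\upharpoonright\Omega_m}$ implies $\mathcal{A}\models\psi$. (iii) For every $m\geq1$, $\mathcal{A}\models\phi_{n,\Omega_m,\mathcal{A}}$. (iv) For every $m\geq1$, $\mathcal{A}\models\phi_{\mathscr{O}_{\cup\Omega_m},\mathcal{A}}$, where $\mathscr{O}_{\cup\Omega_m}=\bigcup_{\mathscr{O}\in\Omega_m}\mathscr{O}$. (v) For every $m\geq1$, $A^m\trianglelefteq\Omega_m$. (vi) For every $m\geq1$, $\Omega_m$ generates $A^m$.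
   Context: $\mathcal{A}$ is a finite structure over a finite relational signature $\sigma$ (constant symbols, if present, are treated as unary relations interpreted by singletons). A polymorphism of arity $k$ is a map $f:A^k\to A$ such that applying $f$ coordinatewise to tuples of any relation gives a tuple of that relation. A pH-sentence is a prenex first-order sentence using only $\exists,\forall,\wedge$ over atomic formulas (including equality); a $\Pi_2$-pH-sentence has quantifier prefix $\forall^*\exists^*$. An adversary of length $m$ is a subset of $A^m$. For a pH-sentence $\phi$ with universal variables $x_1,\dots,x_m$ (in prefix order) and quantifier-free part $\psi$, and an adversary $\mathscr{B}$ of length $m$, $\mathcal{A}\models\phi_{\upharpoonright\mathscr{B}}$ means: there are functions $\sigma_y$, one per existential variable $y$, each mapping values of the universal variables preceding $y$ to $A$, such that for every assignment $\pi$ of the universal variables with $(\pi(x_1),\dots,\pi(x_m))\in\mathscr{B}$, the extension of $\pi$ by $y\mapsto\sigma_y(\pi|_{\text{universals before }y})$ satisfies $\psi$ in $\mathcal{A}$. For a set $\Omega$ of adversaries, $\mathcal{A}\models\phi_{\upharpoonright\Omega}$ means this holds for every member. Projectivity: for $\mathscr{B}\in\Omega_{n\cdot m}$, $\mathrm{Proj}\,\mathscr{B}$ is the set of projections of $\mathscr{B}$ onto coordinates $i_1,\dots,i_m$ with $(j-1)n+1\le i_j\le jn$ for each $j$. $\mathbf{\Omega}$ is projective if for every $m\geq1$ and every $\mathscr{B}\in\Omega_{n\cdot m}$ there is $\mathscr{A}'\in\Omega_m$ containing every member of $\mathrm{Proj}\,\mathscr{B}$. Generation: $\Omega_m$ generates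 an adversary $\mathscr{O}$ if for every $t\in\mathscr{O}$ there are $k$, a $k$-ary polymorphism $f_t$ and tuples $t_1,\dots,t_k\in\bigcup\Omega_m$ with $f_t(t_1,\dots,t_k)=t$ coordinatewise. Reactive composition: for $\Omega_m=\{\mathscr{B}_1,\dots,\mathscr{B}_k\}$, $\mathscr{O}\trianglelefteq\Omega_m$ means there are a $k$-ary polymorphism $f$ of $\mathcal{A}$ and partial functions $g^j_i:A^i\to A$ ($i\in[m]$, $j\in[k]$) such that for every $(a_1,\dots,a_m)\in\mathscr{O}$: for every $j$, the values $g^j_1(a_1),\dots,g^j_m(a_1,\dots,a_m)$ are defined and form a tuple in $\mathscr{B}_j$; and for every $i$, $a_i=f(g^1_i(a_1,\dots,a_i),\dots,g^k_i(a_1,\dots,a_i))$. Canonical sentences: the canonical query of a finite $\sigma$-structure $\mathcal{D}$ is the conjunction, with one variable $v_d$ per $d\in D$, of all atoms $R(v_{d_1},\dots,v_{d_r})$ with $(d_1,\dots,d_r)\in R^{\mathcal{D}}$. Products $\mathcal{D}\otimes\mathcal{E}$ have domain $D\times E$, a relation holds iff it holds in both coordinates, and constants are interpreted coordinatewise. For $\mu:[m]\to A$, $\mathfrak{A}_\mu$ is $\mathcal{A}$ expanded by constants $c_1,\dots,c_m$ with $c_j$ interpreted as $\mu(j)$; for a set $\Omega$ of adversaries of length $m$ let $P_\Omega=\bigotimes_{\mathscr{O}\in\Omega}\bigotimes_{\mu\in\mathscr{O}}\mathfrak{A}_\mu$ (identifying $\mu$ with the tuple $(\mu(1),\dots,\mu(m))$).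 $\phi_{\Omega,\mathcal{A}}$ is the $\Pi_2$-pH-sentence obtained from the canonical query of the $\sigma$-reduct of $P_\Omega$ by renaming the variable of the interpretation of $c_j$ as $w_j$, quantifying $w_1,\dots,w_m$ universally outermost and all other variables existentially; for a single adversary $\mathscr{O}$, $\phi_{\mathscr{O},\mathcal{A}}:=\phi_{\{\mathscr{O}\},\mathcal{A}}$. A map $\mu:[n]\times[m]\to A$ is consistent with $\mathscr{O}$ if $(\mu(i_1,1),\dots,\mu(i_m,m))\in\mathscr{O}$ for all $(i_1,\dots,i_m)\in[n]^m$; $\mathfrak{A}_\mu$ is $\mathcal{A}$ expanded by constants $c_{i,j}$ interpreted as $\mu(i,j)$; $Q_\Omega=\bigotimes_{\mathscr{O}\in\Omega}\bigotimes_{\mu\text{ consistent with }\mathscr{O}}\mathfrak{A}_\mu$, and $\phi_{n,\Omega,\mathcal{A}}$ is obtained from the canonical query of the $\sigma$-reduct of $Q_\Omega$ by renaming the variable of the interpretation of $c_{i,j}$ as $w_{i,j}$, quantified universally outermost, all others existentially. $\Omega$ is degenerate if the interpretations of the constants in $P_\Omega$ or in $Q_\Omega$ are not pairwise distinct (the canonical sentences are only defined for non-degenerate sets).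
   Formalization: In (v), the list B_1,…,B_k may repeat members of Ω_m and need not contain all of them; if k=|Ω_m| were required, or an empty adversary in Ω_m had to be used (e.g. Ω_m={∅,A^m}), (vi) would not imply (v). *)

theory Defs
  imports Main "HOL-Library.FuncSet"
begin

section \<open>Relational structures\<close>

record 'r signature =
  symbols :: "'r set"
  arity :: "'r \<Rightarrow> nat"

record ('r, 'a) rel_structure =
  univ :: "'a set"
  rel :: "'r \<Rightarrow> 'a list set"

record ('r, 'a, 'c) const_structure = "('r, 'a) rel_structure" +
  const :: "'c \<Rightarrow> 'a"

definition tuples :: "'a set \<Rightarrow> nat \<Rightarrow> 'a list set" where
  "tuples A m = {t. length t = m \<and> set t \<subseteq> A}"

definition finite_structure :: "'r signature \<Rightarrow> ('r, 'a) rel_structure \<Rightarrow> bool" where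
  "finite_structure S \<A> \<longleftrightarrow>
     finite (symbols S) \<and> finite (univ \<A>) \<and> univ \<A> \<noteq> {} \<and>
     (\<forall>R\<in>symbols S. rel \<A> R \<subseteq> tuples (univ \<A>) (arity S R))"

definition coordinatewise :: "('a list \<Rightarrow> 'a) \<Rightarrow> nat \<Rightarrow> 'a list list \<Rightarrow> 'a list" where
  "coordinatewise f r ts = map (\<lambda>i. f (map (\<lambda>t. t ! i) ts)) [0..<r]"

definition polymorphism ::
  "'r signature \<Rightarrow> ('r, 'a) rel_structure \<Rightarrow> nat \<Rightarrow> ('a list \<Rightarrow> 'a) \<Rightarrow> bool" where
  "polymorphism S \<A> k f \<longleftrightarrow>
     k \<ge> 1 \<and>
     (\<forall>xs\<in>tuples (univ \<A>) k. f xs \<in> univ \<A>) \<and>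
     (\<forall>R\<in>symbols S. \<forall>ts\<in>tuples (rel \<A> R) k. coordinatewise f (arity S R) ts \<in> rel \<A> R)"


section \<open>Positive Horn sentences\<close>

datatype ('r, 'v) atom = Rel 'r "'v list" | Eq 'v 'v

datatype quantifier = All | Ex

text \<open>A prenex sentence: the quantifier prefix, read from the outside in, and the set of
  conjuncts of the quantifier-free part.\<close>

record ('r, 'v) sentence =
  prefix :: "(quantifier \<times> 'v) list"
  conjuncts :: "('r, 'v) atom set"

fun atom_ok :: "'r signature \<Rightarrow> 'v set \<Rightarrow> ('r, 'v) atom \<Rightarrow> bool" where
  "atom_ok S V (Rel R vs) \<longleftrightarrow> R \<in> symbols S \<and> length vs = arity S R \<and> set vs \<subseteq> V"
| "atom_ok S V (Eq u v) \<longleftrightarrow> u \<in> V \<and> v \<in> V"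

definition pH_sentence :: "'r signature \<Rightarrow> ('r, 'v) sentence \<Rightarrow> bool" where
  "pH_sentence S \<phi> \<longleftrightarrow>
     distinct (map snd (prefix \<phi>)) \<and> finite (conjuncts \<phi>) \<and>
     (\<forall>\<alpha>\<in>conjuncts \<phi>. atom_ok S (set (map snd (prefix \<phi>))) \<alpha>)"

definition Pi2_pH_sentence :: "'r signature \<Rightarrow> ('r, 'v) sentence \<Rightarrow> bool" where
  "Pi2_pH_sentence S \<phi> \<longleftrightarrow>
     pH_sentence S \<phi> \<and> (\<exists>xs ys. prefix \<phi> = map (Pair All) xs @ map (Pair Ex) ys)"

definition universals :: "(quantifier \<times> 'v) list \<Rightarrow> 'v list" where
  "universals Q = map snd (filter (\<lambda>q. fst q = All) Q)"

definition existentials :: "(quantifier \<times> 'v) list \<Rightarrow> 'v list" where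
  "existentials Q = map snd (filter (\<lambda>q. fst q = Ex) Q)"

definition universals_before :: "(quantifier \<times> 'v) list \<Rightarrow> 'v \<Rightarrow> 'v list" where
  "universals_before Q y = universals (takeWhile (\<lambda>q. snd q \<noteq> y) Q)"

fun atom_holds :: "('r, 'a) rel_structure \<Rightarrow> ('v \<Rightarrow> 'a) \<Rightarrow> ('r, 'v) atom \<Rightarrow> bool" where
  "atom_holds \<A> e (Rel R vs) \<longleftrightarrow> map e vs \<in> rel \<A> R"
| "atom_holds \<A> e (Eq u v) \<longleftrightarrow> e u = e v"

fun sat :: "('r, 'a) rel_structure \<Rightarrow> ('v \<Rightarrow> 'a) \<Rightarrow> (quantifier \<times> 'v) list
              \<Rightarrow> ('r, 'v) atom set \<Rightarrow> bool" where
  "sat \<A> e [] C \<longleftrightarrow> (\<forall>\<alpha>\<in>C. atom_holds \<A> e \<alpha>)"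
| "sat \<A> e ((All, x) # Q) C \<longleftrightarrow> (\<forall>a\<in>univ \<A>. sat \<A> (e(x := a)) Q C)"
| "sat \<A> e ((Ex, x) # Q) C \<longleftrightarrow> (\<exists>a\<in>univ \<A>. sat \<A> (e(x := a)) Q C)"

text \<open>The initial environment is irrelevant, as sentences have no free variables.\<close>

definition models :: "('r, 'a) rel_structure \<Rightarrow> ('r, 'v) sentence \<Rightarrow> bool" where
  "models \<A> \<phi> \<longleftrightarrow> sat \<A> (\<lambda>_. undefined) (prefix \<phi>) (conjuncts \<phi>)"


section \<open>Adversaries\<close>

definition adversary :: "'a set \<Rightarrow> nat \<Rightarrow> 'a list set \<Rightarrow> bool" where
  "adversary A m B \<longleftrightarrow> B \<subseteq> tuples A m"

definition skolem_extension ::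
  "(quantifier \<times> 'v) list \<Rightarrow> ('v \<Rightarrow> 'a list \<Rightarrow> 'a) \<Rightarrow> ('v \<Rightarrow> 'a) \<Rightarrow> 'v \<Rightarrow> 'a" where
  "skolem_extension Q \<sigma> \<pi> v =
     (if v \<in> set (existentials Q) then \<sigma> v (map \<pi> (universals_before Q v)) else \<pi> v)"

definition models_adversary ::
  "('r, 'a) rel_structure \<Rightarrow> ('r, 'v) sentence \<Rightarrow> 'a list set \<Rightarrow> bool" where
  "models_adversary \<A> \<phi> B \<longleftrightarrow>
     (\<exists>\<sigma>. (\<forall>y\<in>set (existentials (prefix \<phi>)).
             \<forall>t\<in>tuples (univ \<A>) (length (universals_before (prefix \<phi>) y)). \<sigma> y t \<in> univ \<A>) \<and>
          (\<forall>\<pi>. map \<pi> (universals (prefix \<phi>)) \<in> B \<longrightarrow>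
             (\<forall>\<alpha>\<in>conjuncts \<phi>. atom_holds \<A> (skolem_extension (prefix \<phi>) \<sigma> \<pi>) \<alpha>)))"

definition models_adversaries ::
  "('r, 'a) rel_structure \<Rightarrow> ('r, 'v) sentence \<Rightarrow> 'a list set set \<Rightarrow> bool" where
  "models_adversaries \<A> \<phi> \<Omega> \<longleftrightarrow> (\<forall>B\<in>\<Omega>. models_adversary \<A> \<phi> B)"

text \<open>Coordinates are numbered from 0 throughout.\<close>

definition Proj :: "nat \<Rightarrow> nat \<Rightarrow> 'a list set \<Rightarrow> 'a list set set" where
  "Proj n m B =
     {(\<lambda>t. map (\<lambda>j. t ! \<iota> j) [0..<m]) ` B | \<iota>. \<forall>j<m. j * n \<le> \<iota> j \<and> \<iota> j < (j + 1) * n}"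

definition projective :: "'a set \<Rightarrow> (nat \<Rightarrow> 'a list set set) \<Rightarrow> bool" where
  "projective A \<Omega> \<longleftrightarrow>
     (\<forall>m\<ge>1. \<forall>B\<in>\<Omega> (card A * m). \<exists>B'\<in>\<Omega> m. \<forall>D\<in>Proj (card A) m B. D \<subseteq> B')"

definition generates ::
  "'r signature \<Rightarrow> ('r, 'a) rel_structure \<Rightarrow> nat \<Rightarrow> 'a list set set \<Rightarrow> 'a list set \<Rightarrow> bool" where
  "generates S \<A> m \<Omega> X \<longleftrightarrow>
     (\<forall>t\<in>X. \<exists>k f. polymorphism S \<A> k f \<and> (\<exists>ts\<in>tuples (\<Union>\<Omega>) k. coordinatewise f m ts = t))"

text \<open>\<open>g j i\<close> is the partial function with upper index \<open>j\<close> and lower index \<open>i\<close>; since \<open>i\<close>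
  counts from 0, its arity is \<open>i + 1\<close>.\<close>

definition composable_via ::
  "'a set \<Rightarrow> nat \<Rightarrow> 'a list set \<Rightarrow> ('a list \<Rightarrow> 'a) \<Rightarrow> 'a list set list \<Rightarrow> bool" where
  "composable_via A m X f Bs \<longleftrightarrow>
     (\<exists>g :: nat \<Rightarrow> nat \<Rightarrow> 'a list \<rightharpoonup> 'a.
        (\<forall>j<length Bs. \<forall>i<m. dom (g j i) \<subseteq> tuples A (i + 1) \<and> ran (g j i) \<subseteq> A) \<and>
        (\<forall>a\<in>X.
           (\<forall>j<length Bs.
              (\<forall>i<m. take (i + 1) a \<in> dom (g j i)) \<and>
              map (\<lambda>i. the (g j i (take (i + 1) a))) [0..<m] \<in> Bs ! j) \<and>
           (\<forall>i<m. a ! i = f (map (\<lambda>j. the (g j i (take (i + 1) a))) [0..<length Bs]))))"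

text \<open>The list \<open>Bs\<close> enumerates adversaries of \<open>\<Omega>\<close>. Repetitions are essential: without them a
  one-element \<open>\<Omega>\<close> would only admit unary polymorphisms. A member of \<open>\<Omega>\<close> may be left out of
  \<open>Bs\<close>; this makes a difference only for the empty adversary, no tuple of which can be
  supplied by the functions \<open>g j i\<close>: see \<open>reactive_composition_iff_enumeration\<close> below.\<close>

definition reactive_composition ::
  "'r signature \<Rightarrow> ('r, 'a) rel_structure \<Rightarrow> nat \<Rightarrow> 'a list set \<Rightarrow> 'a list set set \<Rightarrow> bool" where
  "reactive_composition S \<A> m X \<Omega> \<longleftrightarrow>
     (\<exists>Bs f. set Bs \<subseteq> \<Omega> \<and> polymorphism S \<A> (length Bs) f \<and> composable_via (univ \<A>) m X f Bs)"

lemma polymorphism_take: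
  assumes "polymorphism S \<A> k f" and "k \<le> l"
  shows "polymorphism S \<A> l (\<lambda>xs. f (take k xs))"
  unfolding polymorphism_def
proof (intro conjI ballI)
  show "l \<ge> 1" using assms by (simp add: polymorphism_def)
next
  fix xs assume "xs \<in> tuples (univ \<A>) l"
  then have "take k xs \<in> tuples (univ \<A>) k"
    using assms(2) by (auto simp: tuples_def dest: in_set_takeD)
  then show "f (take k xs) \<in> univ \<A>" using assms(1) by (simp add: polymorphism_def)
next
  fix R ts assume R: "R \<in> symbols S" and "ts \<in> tuples (rel \<A> R) l"
  then have "take k ts \<in> tuples (rel \<A> R) k"
    using assms(2) by (auto simp: tuples_def dest: in_set_takeD)
  then have "coordinatewise f (arity S R) (take k ts) \<in> rel \<A> R"
    using assms(1) R by (simp add: polymorphism_def)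
  then show "coordinatewise (\<lambda>xs. f (take k xs)) (arity S R) ts \<in> rel \<A> R"
    by (simp add: coordinatewise_def take_map)
qed

lemma composable_via_append:
  assumes X: "X \<subseteq> tuples A m"
    and Cs: "\<And>C. C \<in> set Cs \<Longrightarrow> C \<noteq> {} \<and> C \<subseteq> tuples A m"
    and "composable_via A m X f Bs"
  shows "composable_via A m X (\<lambda>xs. f (take (length Bs) xs)) (Bs @ Cs)"
proof -
  let ?k = "length Bs"
  define good where "good = (\<lambda>g :: nat \<Rightarrow> nat \<Rightarrow> 'a list \<rightharpoonup> 'a.
    (\<forall>j<?k. \<forall>i<m. dom (g j i) \<subseteq> tuples A (i + 1) \<and> ran (g j i) \<subseteq> A) \<and>
    (\<forall>a\<in>X.
       (\<forall>j<?k. (\<forall>i<m. take (i + 1) a \<in> dom (g j i)) \<and>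
          map (\<lambda>i. the (g j i (take (i + 1) a))) [0..<m] \<in> Bs ! j) \<and>
       (\<forall>i<m. a ! i = f (map (\<lambda>j. the (g j i (take (i + 1) a))) [0..<?k]))))"
  have "\<exists>g. good g" using assms(3) unfolding composable_via_def good_def .
  then obtain g where "good g" ..
  note g = this[unfolded good_def]
  have g1: "dom (g j i) \<subseteq> tuples A (i + 1) \<and> ran (g j i) \<subseteq> A" if "j < ?k" "i < m" for j i
    using conjunct1[OF g] that by simp
  have g2: "take (i + 1) a \<in> dom (g j i)" if "a \<in> X" "j < ?k" "i < m" for a j i
    using conjunct1[OF bspec[OF conjunct2[OF g] that(1)]] that(2,3) by metis
  have g3: "map (\<lambda>i. the (g j i (take (i + 1) a))) [0..<m] \<in> Bs ! j"
    if "a \<in> X" "j < ?k" for a j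
    using conjunct1[OF bspec[OF conjunct2[OF g] that(1)]] that(2) by metis
  have g4: "a ! i = f (map (\<lambda>j. the (g j i (take (i + 1) a))) [0..<?k])"
    if "a \<in> X" "i < m" for a i
    using conjunct2[OF bspec[OF conjunct2[OF g] that(1)]] that(2) by metis
  define c where "c j = (SOME t. t \<in> Cs ! (j - ?k))" for j
  have c: "c j \<in> Cs ! (j - ?k) \<and> c j \<in> tuples A m" if "?k \<le> j" "j < length (Bs @ Cs)" for j
  proof -
    have "Cs ! (j - ?k) \<in> set Cs" using that by simp
    then have "Cs ! (j - ?k) \<noteq> {}" "Cs ! (j - ?k) \<subseteq> tuples A m" using Cs by auto
    then show ?thesis unfolding c_def by (metis some_in_eq subsetD)
  qed
  define h where "h j i = (if j < ?k then g j i
      else (\<lambda>xs. if xs \<in> tuples A (i + 1) then Some (c j ! i) else None))" for j i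
  have tk: "take (i + 1) a \<in> tuples A (i + 1)" if "a \<in> X" "i < m" for a i
    using X that by (auto simp: tuples_def dest: in_set_takeD)
  have h_new: "h j i (take (i + 1) a) = Some (c j ! i)" if "a \<in> X" "i < m" "?k \<le> j" for a i j
    using that tk[OF that(1,2)] by (simp add: h_def)
  have c_nth: "c j ! i \<in> A" if "?k \<le> j" "j < length (Bs @ Cs)" "i < m" for i j
    using c[OF that(1,2)] that(3) by (auto simp: tuples_def dest: nth_mem)
  have h1: "dom (h j i) \<subseteq> tuples A (i + 1)" "ran (h j i) \<subseteq> A"
    if "j < length (Bs @ Cs)" "i < m" for i j
  proof -
    have "dom (h j i) \<subseteq> tuples A (i + 1) \<and> ran (h j i) \<subseteq> A"
    proof (cases "j < ?k")
      case True
      then show ?thesis using g1[OF True that(2)] by (simp add: h_def)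
    next
      case False
      then have "c j ! i \<in> A" using c_nth that by simp
      then show ?thesis using False by (auto simp: h_def ran_def split: if_splits)
    qed
    then show "dom (h j i) \<subseteq> tuples A (i + 1)" "ran (h j i) \<subseteq> A" by auto
  qed
  have h2: "take (i + 1) a \<in> dom (h j i)"
    if "a \<in> X" "j < length (Bs @ Cs)" "i < m" for a i j
  proof (cases "j < ?k")
    case True
    then show ?thesis using g2[OF that(1) True that(3)] by (simp add: h_def)
  next
    case False
    then show ?thesis using h_new[OF that(1,3)] by auto
  qed
  have h3: "map (\<lambda>i. the (h j i (take (i + 1) a))) [0..<m] \<in> (Bs @ Cs) ! j"
    if "a \<in> X" "j < length (Bs @ Cs)" for a j
  proof (cases "j < ?k")
    case True
    then show ?thesis using g3[OF that(1) True] by (simp add: h_def nth_append)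
  next
    case False
    then have "map (\<lambda>i. the (h j i (take (i + 1) a))) [0..<m] = map (\<lambda>i. c j ! i) [0..<m]"
      using h_new[OF that(1)] by auto
    also have "\<dots> = c j" using c[of j] that False by (auto simp: tuples_def intro: map_nth)
    finally show ?thesis using c[of j] that False by (simp add: nth_append)
  qed
  have h4: "a ! i =
      f (take ?k (map (\<lambda>j. the (h j i (take (i + 1) a))) [0..<length (Bs @ Cs)]))"
    if "a \<in> X" "i < m" for a i
  proof -
    have "take ?k (map (\<lambda>j. the (h j i (take (i + 1) a))) [0..<length (Bs @ Cs)])
        = map (\<lambda>j. the (g j i (take (i + 1) a))) [0..<?k]"
      by (auto simp: take_map h_def)
    then show ?thesis using g4[OF that] by simp
  qed
  show ?thesis unfolding composable_via_def
    by (intro exI[of _ h] conjI ballI allI impI; rule h1 h2 h3 h4; assumption)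
qed

lemma reactive_composition_iff_enumeration:
  assumes "finite \<Omega>" and "{} \<notin> \<Omega>" and "\<And>B. B \<in> \<Omega> \<Longrightarrow> adversary (univ \<A>) m B"
    and "adversary (univ \<A>) m X"
  shows "reactive_composition S \<A> m X \<Omega> \<longleftrightarrow>
    (\<exists>Bs f. set Bs = \<Omega> \<and> polymorphism S \<A> (length Bs) f \<and> composable_via (univ \<A>) m X f Bs)"
    (is "?L \<longleftrightarrow> ?R")
proof
  assume ?L
  then obtain Bs f where Bs: "set Bs \<subseteq> \<Omega>" "polymorphism S \<A> (length Bs) f"
    "composable_via (univ \<A>) m X f Bs"
    unfolding reactive_composition_def by blast
  obtain Cs where Cs: "set Cs = \<Omega>" using finite_list[OF assms(1)] by blast
  let ?f = "\<lambda>xs. f (take (length Bs) xs)"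
  have "polymorphism S \<A> (length (Bs @ Cs)) ?f" by (rule polymorphism_take[OF Bs(2)]) simp
  moreover have "composable_via (univ \<A>) m X ?f (Bs @ Cs)"
    using assms Cs by (intro composable_via_append Bs(3)) (auto simp: adversary_def)
  moreover have "set (Bs @ Cs) = \<Omega>" using Bs(1) Cs by auto
  ultimately show ?R by blast
next
  assume ?R
  then show ?L unfolding reactive_composition_def by blast
qed


section \<open>Canonical sentences\<close>

definition expand ::
  "('r, 'a) rel_structure \<Rightarrow> ('c \<Rightarrow> 'a) \<Rightarrow> ('r, 'a, 'c) const_structure" where
  "expand \<A> \<mu> = \<lparr>univ = univ \<A>, rel = rel \<A>, const = \<mu>\<rparr>"

definition reduct :: "('r, 'a, 'c) const_structure \<Rightarrow> ('r, 'a) rel_structure" where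
  "reduct \<D> = \<lparr>univ = univ \<D>, rel = rel \<D>\<rparr>"

definition product ::
  "'r signature \<Rightarrow> 'i set \<Rightarrow> ('i \<Rightarrow> ('r, 'a, 'c) const_structure)
     \<Rightarrow> ('r, 'i \<Rightarrow> 'a, 'c) const_structure" where
  "product S I \<D> =
     \<lparr>univ = (\<Pi>\<^sub>E i\<in>I. univ (\<D> i)),
      rel = (\<lambda>R. {ds \<in> tuples (\<Pi>\<^sub>E i\<in>I. univ (\<D> i)) (arity S R).
                    \<forall>i\<in>I. map (\<lambda>d. d i) ds \<in> rel (\<D> i) R}),
      const = (\<lambda>c. \<lambda>i\<in>I. const (\<D> i) c)\<rparr>"

text \<open>The elements of the structure themselves serve as the variables.\<close>

definition canonical_query :: "'r signature \<Rightarrow> ('r, 'd) rel_structure \<Rightarrow> ('r, 'd) atom set" where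
  "canonical_query S \<D> = {Rel R ds | R ds. R \<in> symbols S \<and> ds \<in> rel \<D> R}"

text \<open>The variable \<open>w\<^sub>c\<close> is the element \<open>const \<D> c\<close>. The list \<open>cs\<close> gives the constants in the
  order in which their variables are quantified; the order of the existential block is
  immaterial.\<close>

definition canonical_sentence ::
  "'r signature \<Rightarrow> 'c list \<Rightarrow> ('r, 'd, 'c) const_structure \<Rightarrow> ('r, 'd) sentence" where
  "canonical_sentence S cs \<D> =
     \<lparr>prefix =
        map (\<lambda>c. (All, const \<D> c)) cs @
        map (Pair Ex) (SOME ys. distinct ys \<and> set ys = univ \<D> - const \<D> ` set cs),
      conjuncts = canonical_query S (reduct \<D>)\<rparr>"

definition P_structure ::
  "'r signature \<Rightarrow> ('r, 'a) rel_structure \<Rightarrow> 'a list set set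
     \<Rightarrow> ('r, 'a list set \<Rightarrow> 'a list \<Rightarrow> 'a, nat) const_structure" where
  "P_structure S \<A> \<Omega> = product S \<Omega> (\<lambda>X. product S X (\<lambda>t. expand \<A> (\<lambda>j. t ! j)))"

definition phi ::
  "'r signature \<Rightarrow> ('r, 'a) rel_structure \<Rightarrow> nat \<Rightarrow> 'a list set set
     \<Rightarrow> ('r, 'a list set \<Rightarrow> 'a list \<Rightarrow> 'a) sentence" where
  "phi S \<A> m \<Omega> = canonical_sentence S [0..<m] (P_structure S \<A> \<Omega>)"

definition consistent_maps ::
  "'a set \<Rightarrow> nat \<Rightarrow> nat \<Rightarrow> 'a list set \<Rightarrow> (nat \<times> nat \<Rightarrow> 'a) set" where
  "consistent_maps A n m X =
     {\<mu> \<in> {..<n} \<times> {..<m} \<rightarrow>\<^sub>E A.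
        \<forall>\<iota>\<in>tuples {..<n} m. map (\<lambda>j. \<mu> (\<iota> ! j, j)) [0..<m] \<in> X}"

definition Q_structure ::
  "'r signature \<Rightarrow> ('r, 'a) rel_structure \<Rightarrow> nat \<Rightarrow> nat \<Rightarrow> 'a list set set
     \<Rightarrow> ('r, 'a list set \<Rightarrow> (nat \<times> nat \<Rightarrow> 'a) \<Rightarrow> 'a, nat \<times> nat) const_structure" where
  "Q_structure S \<A> n m \<Omega> =
     product S \<Omega> (\<lambda>X. product S (consistent_maps (univ \<A>) n m X) (\<lambda>\<mu>. expand \<A> \<mu>))"

text \<open>The variables \<open>w\<^bsub>i,j\<^esub>\<close> are quantified in \<open>m\<close> consecutive blocks of length \<open>n\<close>, one for each \<open>j\<close>,
  matching the blocks of coordinates used in \<open>Proj\<close>.\<close>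

definition phi_n ::
  "'r signature \<Rightarrow> ('r, 'a) rel_structure \<Rightarrow> nat \<Rightarrow> nat \<Rightarrow> 'a list set set
     \<Rightarrow> ('r, 'a list set \<Rightarrow> (nat \<times> nat \<Rightarrow> 'a) \<Rightarrow> 'a) sentence" where
  "phi_n S \<A> n m \<Omega> =
     canonical_sentence S [(i, j). j \<leftarrow> [0..<m], i \<leftarrow> [0..<n]] (Q_structure S \<A> n m \<Omega>)"

definition degenerate ::
  "'r signature \<Rightarrow> ('r, 'a) rel_structure \<Rightarrow> nat \<Rightarrow> 'a list set set \<Rightarrow> bool" where
  "degenerate S \<A> m \<Omega> \<longleftrightarrow>
     \<not> inj_on (const (P_structure S \<A> \<Omega>)) {..<m} \<or>
     \<not> inj_on (const (Q_structure S \<A> (card (univ \<A>)) m \<Omega>)) ({..<card (univ \<A>)} \<times> {..<m})"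


definition all_equivalent :: "bool list \<Rightarrow> bool" where
  "all_equivalent ps \<longleftrightarrow> (\<forall>p\<in>set ps. \<forall>q\<in>set ps. p \<longleftrightarrow> q)"

end

theory Submission
  imports Defs
begin

text \<open>
  A homomorphism from a product of copies of \<open>\<A>\<close> to \<open>\<A>\<close> is a polymorphism, so a canonical sentence
  holds in \<open>\<A>\<close> iff every choice of values for the universal variables is the image, under some
  polymorphism, of the tuples interpreting the constants. For \<open>phi\<close> this is generation, (iv) iff
  (vi). The remaining implications go (i) to (ii) to (iii) to (v) to (i), and (v) to (vi) to (ii).

  (ii) to (iii): by projectivity each tuple of an adversary of length \<open>n * m\<close> is a consistent map,
  and the corresponding coordinate projection of the product witnesses the sentence for it.
  (iii) to (v): give \<open>w\<^bsub>i,j\<^esub>\<close> the value of the \<open>i\<close>-th element of the structure; the resulting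
  polymorphism composes with the functions \<open>x \<mapsto> \<mu> (x, j)\<close>, one for each consistent \<open>\<mu>\<close>.
  (v) to (i): compose the Skolem functions for the individual adversaries with the polymorphism.
  (vi) to (ii): apply the polymorphism that generates a tuple to witnesses for the generating tuples.
\<close>

section \<open>Skolem functions and satisfaction\<close>

lemma ex_map_eq:
  assumes "distinct xs" and "length t = length xs"
  shows "\<exists>e. map e xs = t"
proof -
  have "map (\<lambda>x. the (map_of (zip xs t) x)) xs = t"
    using assms by (intro nth_equalityI) (simp_all add: map_of_zip_nth)
  then show ?thesis by blast
qed

lemma nth_in_tuples: "t \<in> tuples A m \<Longrightarrow> i < m \<Longrightarrow> t ! i \<in> A"
  by (auto simp: tuples_def)

section \<open>Atoms under changes of the assignment\<close>

lemma atom_holds_cong: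
  assumes "atom_ok S V \<alpha>" and "\<And>v. v \<in> V \<Longrightarrow> e v = e' v"
  shows "atom_holds \<A> e \<alpha> \<longleftrightarrow> atom_holds \<A> e' \<alpha>"
proof (cases \<alpha>)
  case (Rel R vs)
  then have "map e vs = map e' vs" using assms by auto
  then show ?thesis using Rel by (simp del: map_eq_conv)
next
  case (Eq u v)
  then show ?thesis using assms by simp
qed

text \<open>For a relation, the values of the \<open>k\<close> assignments form \<open>k\<close>
  tuples of it, which \<open>f\<close> preserves; for an equation, both variables give
  \<open>f\<close> the same argument list.\<close>

lemma atom_holds_polymorphism:
  assumes pol: "polymorphism S \<A> k f" and ok: "atom_ok S V \<alpha>"
    and e: "\<And>j. j < k \<Longrightarrow> atom_holds \<A> (e j) \<alpha>"
    and e': "\<And>v. v \<in> V \<Longrightarrow> e' v = f (map (\<lambda>j. e j v) [0..<k])"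
  shows "atom_holds \<A> e' \<alpha>"
proof (cases \<alpha>)
  case (Rel R vs)
  \<comment> \<open>The assignments give the rows; the column at position \<open>i\<close> is the
    argument list of \<open>f\<close> for the variable \<open>vs ! i\<close>.\<close>
  define ts where "ts = map (\<lambda>j. map (e j) vs) [0..<k]"
  have "ts \<in> tuples (rel \<A> R) k" using e Rel by (auto simp: ts_def tuples_def)
  then have "coordinatewise f (arity S R) ts \<in> rel \<A> R"
    using pol ok Rel by (auto simp: polymorphism_def)
  moreover have "coordinatewise f (arity S R) ts = map e' vs"
  proof (rule nth_equalityI)
    fix i assume "i < length (coordinatewise f (arity S R) ts)"
    then have i: "i < arity S R" "i < length vs" using ok Rel by (auto simp: coordinatewise_def)
    then have "vs ! i \<in> V" using ok Rel by auto
    have "map (\<lambda>t. t ! i) ts = map (\<lambda>j. e j (vs ! i)) [0..<k]"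
      using i by (simp add: ts_def)
    then show "coordinatewise f (arity S R) ts ! i = map e' vs ! i"
      using i e'[OF \<open>vs ! i \<in> V\<close>] by (simp add: coordinatewise_def)
  qed (use ok Rel in \<open>simp add: coordinatewise_def\<close>)
  ultimately show ?thesis using Rel by simp
next
  case (Eq u v)
  then have "map (\<lambda>j. e j u) [0..<k] = map (\<lambda>j. e j v) [0..<k]" using e by simp
  then show ?thesis using Eq ok e' by (simp del: map_eq_conv)
qed

section \<open>Universal variables along a quantifier prefix\<close>

lemma universals_append [simp]: "universals (P @ Q) = universals P @ universals Q"
  by (simp add: universals_def)

lemma set_universals: "v \<in> set (universals Q) \<longleftrightarrow> (All, v) \<in> set Q"
  by (force simp: universals_def)

lemma set_existentials: "v \<in> set (existentials Q) \<longleftrightarrow> (Ex, v) \<in> set Q"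
  by (force simp: existentials_def)

lemma universals_or_existentials:
  assumes "v \<in> set (map snd Q)"
  shows "v \<in> set (universals Q) \<or> v \<in> set (existentials Q)"
proof -
  obtain q where "(q, v) \<in> set Q" using assms by auto
  then show ?thesis by (cases q) (auto simp: set_universals set_existentials)
qed

lemma distinct_universals: "distinct (map snd Q) \<Longrightarrow> distinct (universals Q)"
  by (simp add: universals_def distinct_map_filter)

text \<open>The arguments of a Skolem function are an initial segment of the values of all universal
  variables; this fits Skolem functions together with the \<open>take\<close> in reactive
  composition.\<close>

lemma universals_before_take:
  "universals_before Q y = take (length (universals_before Q y)) (universals Q)"
proof -
  have "universals Q = universals_before Q y @ universals (dropWhile (\<lambda>q. snd q \<noteq> y) Q)"
    unfolding universals_before_def by (simp flip: universals_append)
  then show ?thesis by (metis append_eq_conv_conj)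
qed

lemma length_universals_before: "length (universals_before Q y) \<le> length (universals Q)"
  by (subst universals_before_take) simp

lemma universals_before_append:
  assumes "y \<in> set (map snd P)"
  shows "universals_before (P @ Q) y = universals_before P y"
proof -
  obtain q where "(q, y) \<in> set P" using assms by auto
  then show ?thesis by (simp add: universals_before_def)
qed

lemma set_universals_before: "set (universals_before Q y) \<subseteq> set (map snd Q)"
  by (auto simp: universals_before_def set_universals dest!: set_takeWhileD)
     (force dest!: set_takeWhileD)+

lemma universals_before_split:
  assumes "y \<notin> set (map snd P)"
  shows "universals_before (P @ (q, y) # Q) y = universals P"
proof -
  have "takeWhile (\<lambda>q. snd q \<noteq> y) (P @ (q, y) # Q) = P @ takeWhile (\<lambda>q. snd q \<noteq> y) ((q, y) # Q)"
    using assms by (intro takeWhile_append2) force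
  then show ?thesis by (simp add: universals_before_def)
qed

text \<open>The full adversary admits every assignment of the universal variables, so following its
  Skolem functions at each existential quantifier yields recursive satisfaction.\<close>

lemma models_if_models_adversary_tuples:
  assumes \<phi>: "pH_sentence S \<phi>"
    and "models_adversary \<A> \<phi> (tuples (univ \<A>) (length (universals (prefix \<phi>))))"
  shows "models \<A> \<phi>"
proof -
  define Q where "Q = prefix \<phi>"
  define C where "C = conjuncts \<phi>"
  obtain \<sigma> where \<sigma>: "\<And>y t. y \<in> set (existentials Q) \<Longrightarrow>
      t \<in> tuples (univ \<A>) (length (universals_before Q y)) \<Longrightarrow> \<sigma> y t \<in> univ \<A>"
    and C: "\<And>\<pi> \<alpha>. map \<pi> (universals Q) \<in> tuples (univ \<A>) (length (universals Q)) \<Longrightarrow>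
       \<alpha> \<in> C \<Longrightarrow> atom_holds \<A> (skolem_extension Q \<sigma> \<pi>) \<alpha>"
    using assms(2) unfolding models_adversary_def Q_def C_def by blast
  have dist: "distinct (map snd Q)" and ok: "\<And>\<alpha>. \<alpha> \<in> C \<Longrightarrow> atom_ok S (set (map snd Q)) \<alpha>"
    using \<phi> by (auto simp: pH_sentence_def Q_def C_def)
  \<comment> \<open>Invariant: once the part \<open>P\<close> of the prefix has been read,
    \<open>e\<close> gives its variables values in the universe and agrees with the Skolem functions
    on its existential ones.\<close>
  have "sat \<A> e R C"
    if "Q = P @ R" "\<And>v. v \<in> set (map snd P) \<Longrightarrow> e v \<in> univ \<A>"
      "\<And>y. y \<in> set (existentials P) \<Longrightarrow> e y = \<sigma> y (map e (universals_before Q y))" for P R e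
    using that
  proof (induction R arbitrary: P e)
    case Nil
    have "map e (universals Q) \<in> tuples (univ \<A>) (length (universals Q))"
      using Nil by (fastforce simp: tuples_def set_universals)
    \<comment> \<open>With the whole prefix read, the invariant says that \<open>e\<close> is its
      own Skolem extension.\<close>
    moreover have "skolem_extension Q \<sigma> e = e"
      using Nil by (auto simp: skolem_extension_def)
    ultimately show ?case using C[of e] by simp
  next
    case (Cons qx R)
    obtain q x where qx: "qx = (q, x)" by (cases qx)
    have x: "x \<notin> set (map snd P)" using dist Cons.prems(1) qx by auto
    \<comment> \<open>The arguments of an earlier Skolem function occur in \<open>P\<close>, hence
      are untouched by an update at the new variable \<open>x\<close>.\<close>
    have before: "map (e(x := a)) (universals_before Q y) = map e (universals_before Q y)"
      if "y \<in> set (existentials P)" for a y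
    proof -
      have "y \<in> set (map snd P)" using that by (force simp: set_existentials)
      then have "set (universals_before Q y) \<subseteq> set (map snd P)"
        using Cons.prems(1) set_universals_before[of P y] by (simp add: universals_before_append)
      then show ?thesis using x by auto
    qed
    have skolem: "(e(x := a)) y = \<sigma> y (map (e(x := a)) (universals_before Q y))"
      if "y \<in> set (existentials P)" for a y
    proof -
      have "y \<noteq> x" using that x by (force simp: set_existentials)
      then show ?thesis using Cons.prems(3)[OF that] before[OF that] by (metis fun_upd_other)
    qed
    have Q: "Q = (P @ [(q, x)]) @ R" using Cons.prems(1) qx by simp
    show ?case
    proof (cases q)
      case All
      have "sat \<A> (e(x := a)) R C" if "a \<in> univ \<A>" for a
      proof (rule Cons.IH[OF Q])
        show "(e(x := a)) v \<in> univ \<A>" if "v \<in> set (map snd (P @ [(q, x)]))" for v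
          using that \<open>a \<in> univ \<A>\<close> Cons.prems(2) by auto
        show "(e(x := a)) y = \<sigma> y (map (e(x := a)) (universals_before Q y))"
          if "y \<in> set (existentials (P @ [(q, x)]))" for y
        proof (rule skolem)
          show "y \<in> set (existentials P)" using that All by (auto simp: set_existentials)
        qed
      qed
      then show ?thesis using qx All by simp
    next
      case Ex
      \<comment> \<open>The Skolem value at the universal variables read so far, which are exactly
        those before \<open>x\<close>.\<close>
      define a where "a = \<sigma> x (map e (universals_before Q x))"
      have bx: "universals_before Q x = universals P"
        using universals_before_split[OF x] Q by simp
      have "x \<in> set (existentials Q)" using Q Ex by (auto simp: set_existentials)
      moreover have "map e (universals P) \<in> tuples (univ \<A>) (length (universals P))"
        using Cons.prems(2) by (fastforce simp: tuples_def set_universals)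
      ultimately have a: "a \<in> univ \<A>" using \<sigma> bx by (simp add: a_def)
      have "x \<notin> set (universals P)" using x by (force simp: set_universals)
      then have "map (e(x := a)) (universals_before Q x) = map e (universals_before Q x)"
        using bx by auto
      then have skolem_x: "(e(x := a)) x = \<sigma> x (map (e(x := a)) (universals_before Q x))"
        by (simp only: fun_upd_same a_def)
      have "sat \<A> (e(x := a)) R C"
      proof (rule Cons.IH[OF Q])
        show "(e(x := a)) v \<in> univ \<A>" if "v \<in> set (map snd (P @ [(q, x)]))" for v
          using that a Cons.prems(2) by auto
        fix y assume "y \<in> set (existentials (P @ [(q, x)]))"
        then have "y = x \<or> y \<in> set (existentials P)"
          using Ex by (auto simp: set_existentials)
        then show "(e(x := a)) y = \<sigma> y (map (e(x := a)) (universals_before Q y))"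
          using skolem[of y a] skolem_x by (elim disjE) (simp_all only:)
      qed
      then show ?thesis using qx Ex a by auto
    qed
  qed
  from this[of "[]"] show ?thesis by (simp add: models_def Q_def C_def existentials_def)
qed


section \<open>Sentences with prefix \<open>\<forall>\<^sup>*\<exists>\<^sup>*\<close>\<close>

text \<open>The condition for a single tuple of values of the universal block. Satisfaction and
  satisfaction on an adversary both quantify it over tuples, which makes them comparable.\<close>

definition Pi2_witness ::
  "('r, 'a) rel_structure \<Rightarrow> 'v list \<Rightarrow> 'v list \<Rightarrow> ('r, 'v) atom set \<Rightarrow> 'a list \<Rightarrow> bool" where
  "Pi2_witness \<A> xs ys C t \<longleftrightarrow>
     (\<exists>e. map e xs = t \<and> e ` set ys \<subseteq> univ \<A> \<and> (\<forall>\<alpha>\<in>C. atom_holds \<A> e \<alpha>))"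

lemma sat_All_block:
  "sat \<A> e (map (Pair All) xs @ Q) C \<longleftrightarrow>
     (\<forall>e'. e' ` set xs \<subseteq> univ \<A> \<and> (\<forall>v. v \<notin> set xs \<longrightarrow> e' v = e v) \<longrightarrow> sat \<A> e' Q C)"
proof (induction xs arbitrary: e)
  case Nil
  have "e' = e" if "\<forall>v. e' v = e v" for e' using that by auto
  then show ?case by auto
next
  case (Cons x xs)
  show ?case (is "?L \<longleftrightarrow> ?R")
  proof
    assume L: ?L
    show ?R
    proof (intro allI impI, elim conjE)
      fix e' assume e': "e' ` set (x # xs) \<subseteq> univ \<A>" "\<forall>v. v \<notin> set (x # xs) \<longrightarrow> e' v = e v"
      then have "sat \<A> (e(x := e' x)) (map (Pair All) xs @ Q) C" using L by simp
      then show "sat \<A> e' Q C" using e' unfolding Cons.IH by auto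
    qed
  next
    assume R: ?R
    show ?L
    proof (simp, intro ballI, unfold Cons.IH, intro allI impI, elim conjE)
      fix a e' assume a: "a \<in> univ \<A>" "e' ` set xs \<subseteq> univ \<A>"
        "\<forall>v. v \<notin> set xs \<longrightarrow> e' v = (e(x := a)) v"
      \<comment> \<open>\<open>x\<close> may occur again in \<open>xs\<close>, and then
        \<open>e' x\<close> is a value of that later quantifier.\<close>
      then have "e' x \<in> univ \<A>" by (cases "x \<in> set xs") auto
      then show "sat \<A> e' Q C" using R a by auto
    qed
  qed
qed

lemma sat_Ex_block:
  "sat \<A> e (map (Pair Ex) ys) C \<longleftrightarrow>
     (\<exists>e'. e' ` set ys \<subseteq> univ \<A> \<and> (\<forall>v. v \<notin> set ys \<longrightarrow> e' v = e v) \<and> sat \<A> e' [] C)"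
proof (induction ys arbitrary: e)
  case Nil
  have "e' = e" if "\<forall>v. e' v = e v" for e' using that by auto
  then show ?case by auto
next
  case (Cons y ys)
  show ?case (is "?L \<longleftrightarrow> ?R")
  proof
    assume ?L
    then obtain a where "a \<in> univ \<A>" "sat \<A> (e(y := a)) (map (Pair Ex) ys) C" by auto
    then obtain e' where e': "a \<in> univ \<A>" "e' ` set ys \<subseteq> univ \<A>"
      "\<forall>v. v \<notin> set ys \<longrightarrow> e' v = (e(y := a)) v" "sat \<A> e' [] C"
      unfolding Cons.IH by blast
    then have "e' y \<in> univ \<A>" by (cases "y \<in> set ys") auto
    then show ?R using e' by (intro exI[of _ e']) auto
  next
    assume ?R
    then obtain e' where e': "e' ` set (y # ys) \<subseteq> univ \<A>"
      "\<forall>v. v \<notin> set (y # ys) \<longrightarrow> e' v = e v" "sat \<A> e' [] C" by blast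
    then have "sat \<A> (e(y := e' y)) (map (Pair Ex) ys) C"
      unfolding Cons.IH by (intro exI[of _ e']) auto
    then show ?L using e'(1) by auto
  qed
qed

text \<open>The block lemmas produce environments that keep the initial \<open>undefined\<close> off
  the quantified variables; the conjuncts mention only \<open>xs\<close> and \<open>ys\<close>, so
  these can be exchanged for arbitrary environments.\<close>

lemma models_Pi2_iff:
  assumes \<phi>: "pH_sentence S \<phi>" and pre: "prefix \<phi> = map (Pair All) xs @ map (Pair Ex) ys"
  shows "models \<A> \<phi> \<longleftrightarrow>
    (\<forall>t\<in>tuples (univ \<A>) (length xs). Pi2_witness \<A> xs ys (conjuncts \<phi>) t)"
    (is "?L \<longleftrightarrow> ?R")
proof -
  have dist: "distinct (xs @ ys)" using \<phi> by (simp add: pH_sentence_def pre comp_def)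
  have ok: "atom_ok S (set xs \<union> set ys) \<alpha>" if "\<alpha> \<in> conjuncts \<phi>" for \<alpha>
    using \<phi> that by (simp add: pH_sentence_def pre comp_def image_image)
  have *: "?L \<longleftrightarrow> (\<forall>e. e ` set xs \<subseteq> univ \<A> \<and> (\<forall>v. v \<notin> set xs \<longrightarrow> e v = undefined) \<longrightarrow>
      (\<exists>e'. e' ` set ys \<subseteq> univ \<A> \<and> (\<forall>v. v \<notin> set ys \<longrightarrow> e' v = e v) \<and>
        (\<forall>\<alpha>\<in>conjuncts \<phi>. atom_holds \<A> e' \<alpha>)))"
    unfolding models_def pre sat_All_block sat_Ex_block by simp
  show ?thesis
  proof
    assume L: ?L
    show ?R
    proof
      fix t assume t: "t \<in> tuples (univ \<A>) (length xs)"
      then obtain e where e: "map e xs = t"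
        using ex_map_eq[of xs t] dist by (auto simp: tuples_def)
      let ?e = "\<lambda>v. if v \<in> set xs then e v else undefined"
      have "?e ` set xs \<subseteq> univ \<A>" using e t by (auto simp: tuples_def)
      then obtain e' where e': "e' ` set ys \<subseteq> univ \<A>" "\<forall>v. v \<notin> set ys \<longrightarrow> e' v = ?e v"
        "\<forall>\<alpha>\<in>conjuncts \<phi>. atom_holds \<A> e' \<alpha>"
        using L[unfolded *, rule_format, of ?e] by auto
      have "map e' xs = t" unfolding e[symmetric] using e'(2) dist by auto
      then show "Pi2_witness \<A> xs ys (conjuncts \<phi>) t" using e' by (auto simp: Pi2_witness_def)
    qed
  next
    assume R: ?R
    show ?L unfolding *
    proof (intro allI impI, elim conjE)
      fix e assume e: "e ` set xs \<subseteq> univ \<A>" "\<forall>v. v \<notin> set xs \<longrightarrow> e v = undefined"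
      then have "map e xs \<in> tuples (univ \<A>) (length xs)" by (simp add: tuples_def)
      then obtain e' where e': "map e' xs = map e xs" "e' ` set ys \<subseteq> univ \<A>"
        "\<forall>\<alpha>\<in>conjuncts \<phi>. atom_holds \<A> e' \<alpha>"
        using R unfolding Pi2_witness_def by meson
      \<comment> \<open>\<open>e'\<close> is only known to agree with \<open>e\<close> on
        \<open>xs\<close>; off \<open>ys\<close> the value of \<open>e\<close> is restored, as the
        block lemma demands.\<close>
      let ?e = "\<lambda>v. if v \<in> set ys then e' v else e v"
      have "atom_holds \<A> ?e \<alpha>" if "\<alpha> \<in> conjuncts \<phi>" for \<alpha>
      proof -
        have "atom_holds \<A> ?e \<alpha> \<longleftrightarrow> atom_holds \<A> e' \<alpha>"
          by (rule atom_holds_cong[OF ok[OF that]]) (use e'(1) in auto)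
        then show ?thesis using e'(3) that by simp
      qed
      then show "\<exists>e'. e' ` set ys \<subseteq> univ \<A> \<and> (\<forall>v. v \<notin> set ys \<longrightarrow> e' v = e v) \<and>
          (\<forall>\<alpha>\<in>conjuncts \<phi>. atom_holds \<A> e' \<alpha>)"
        using e'(2) by (intro exI[of _ ?e]) auto
    qed
  qed
qed

text \<open>All universal variables precede every existential one, so a Skolem function sees the
  whole tuple, and a choice of Skolem functions amounts to one witness per tuple of
  \<open>B\<close>.\<close>

lemma models_adversary_Pi2_iff:
  assumes \<phi>: "pH_sentence S \<phi>" and pre: "prefix \<phi> = map (Pair All) xs @ map (Pair Ex) ys"
    and B: "B \<subseteq> tuples (univ \<A>) (length xs)" and ne: "univ \<A> \<noteq> {}"
  shows "models_adversary \<A> \<phi> B \<longleftrightarrow> (\<forall>t\<in>B. Pi2_witness \<A> xs ys (conjuncts \<phi>) t)"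
    (is "?L \<longleftrightarrow> ?R")
proof -
  have dist: "distinct (xs @ ys)" using \<phi> by (simp add: pH_sentence_def pre comp_def)
  have ok: "atom_ok S (set xs \<union> set ys) \<alpha>" if "\<alpha> \<in> conjuncts \<phi>" for \<alpha>
    using \<phi> that by (simp add: pH_sentence_def pre comp_def image_image)
  have u: "universals (prefix \<phi>) = xs" and ex: "existentials (prefix \<phi>) = ys"
    by (simp_all add: pre universals_def existentials_def comp_def filter_False)
  have ub: "universals_before (prefix \<phi>) y = xs" if y: "y \<in> set ys" for y
  proof -
    obtain ys1 ys2 where ys: "ys = ys1 @ y # ys2" "y \<notin> set ys1"
      using split_list_first[OF y] by blast
    have "y \<notin> set (map snd (map (Pair All) xs @ map (Pair Ex) ys1))"
      using dist ys by (auto simp: image_image)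
    from universals_before_split[OF this, of Ex "map (Pair Ex) ys2"]
    have "universals_before (prefix \<phi>) y = universals (map (Pair All) xs @ map (Pair Ex) ys1)"
      by (simp only: pre ys(1) map_append list.map append_assoc append_Cons)
    then show ?thesis by (simp add: universals_def comp_def filter_False)
  qed
  show ?thesis
  proof
    assume ?L
    then obtain \<sigma> where \<sigma>': "\<forall>y\<in>set ys.
        \<forall>t\<in>tuples (univ \<A>) (length (universals_before (prefix \<phi>) y)). \<sigma> y t \<in> univ \<A>"
      and C: "\<forall>\<pi>. map \<pi> xs \<in> B \<longrightarrow> (\<forall>\<alpha>\<in>conjuncts \<phi>.
        atom_holds \<A> (skolem_extension (prefix \<phi>) \<sigma> \<pi>) \<alpha>)"
      unfolding models_adversary_def u ex by (elim exE conjE) (rule that)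
    have \<sigma>: "\<sigma> y t \<in> univ \<A>" if "y \<in> set ys" "t \<in> tuples (univ \<A>) (length xs)" for y t
      using \<sigma>' that ub by simp
    show ?R
    proof
      fix t assume t: "t \<in> B"
      then have tt: "t \<in> tuples (univ \<A>) (length xs)" using B by auto
      then obtain \<pi> where \<pi>: "map \<pi> xs = t"
        using ex_map_eq[of xs t] dist by (auto simp: tuples_def)
      let ?e = "skolem_extension (prefix \<phi>) \<sigma> \<pi>"
      have "map ?e xs = t"
        unfolding \<pi>[symmetric] using dist by (auto simp: skolem_extension_def ex)
      moreover have "?e ` set ys \<subseteq> univ \<A>"
        using \<sigma> \<pi> tt by (auto simp: skolem_extension_def ex ub)
      moreover have "\<forall>\<alpha>\<in>conjuncts \<phi>. atom_holds \<A> ?e \<alpha>" using C \<pi> t by simp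
      ultimately show "Pi2_witness \<A> xs ys (conjuncts \<phi>) t"
        unfolding Pi2_witness_def by (intro exI conjI)
    qed
  next
    assume ?R
    then have "\<forall>t\<in>B. \<exists>e. map e xs = t \<and> e ` set ys \<subseteq> univ \<A> \<and>
        (\<forall>\<alpha>\<in>conjuncts \<phi>. atom_holds \<A> e \<alpha>)"
      by (simp add: Pi2_witness_def)
    then obtain e where e: "\<forall>t\<in>B. map (e t) xs = t \<and> e t ` set ys \<subseteq> univ \<A> \<and>
        (\<forall>\<alpha>\<in>conjuncts \<phi>. atom_holds \<A> (e t) \<alpha>)"
      by (elim exE[OF bchoice])
    obtain a where a: "a \<in> univ \<A>" using ne by blast
    \<comment> \<open>Skolem functions must stay in the universe on tuples outside \<open>B\<close>
      as well, hence the default \<open>a\<close>.\<close>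
    define \<sigma> where "\<sigma> y t = (if t \<in> B then e t y else a)" for y t
    have "\<sigma> y t \<in> univ \<A>" if "y \<in> set ys" for y t
      using e a that by (auto simp: \<sigma>_def)
    moreover have "atom_holds \<A> (skolem_extension (prefix \<phi>) \<sigma> \<pi>) \<alpha>"
      if "map \<pi> xs \<in> B" "\<alpha> \<in> conjuncts \<phi>" for \<pi> \<alpha>
    proof -
      have m: "map (e (map \<pi> xs)) xs = map \<pi> xs" using e that(1) by blast
      have "atom_holds \<A> (skolem_extension (prefix \<phi>) \<sigma> \<pi>) \<alpha> \<longleftrightarrow> atom_holds \<A> (e (map \<pi> xs)) \<alpha>"
        by (rule atom_holds_cong[OF ok[OF that(2)]])
          (use m that(1) in \<open>auto simp: skolem_extension_def ex ub \<sigma>_def\<close>)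
      then show ?thesis using e that by blast
    qed
    ultimately show ?L unfolding models_adversary_def u ex by (intro exI[of _ \<sigma>]) simp
  qed
qed

text \<open>Conditions (i) and (ii) concern sentences with variables in \<open>nat\<close>, while
  the variables of a canonical sentence are elements of a product; renaming passes between
  them.\<close>

definition rename :: "('v \<Rightarrow> 'w) \<Rightarrow> ('r, 'v) sentence \<Rightarrow> ('r, 'w) sentence" where
  "rename \<rho> \<phi> = \<lparr>prefix = map (apsnd \<rho>) (prefix \<phi>), conjuncts = map_atom id \<rho> ` conjuncts \<phi>\<rparr>"

lemma atom_holds_map_atom: "atom_holds \<A> e (map_atom id \<rho> \<alpha>) \<longleftrightarrow> atom_holds \<A> (e \<circ> \<rho>) \<alpha>"
  by (cases \<alpha>) auto

lemma atom_ok_map_atom: "atom_ok S V \<alpha> \<Longrightarrow> atom_ok S (\<rho> ` V) (map_atom id \<rho> \<alpha>)"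
  by (cases \<alpha>) auto

lemma pH_sentence_rename:
  assumes "pH_sentence S \<phi>" and "inj_on \<rho> (set (map snd (prefix \<phi>)))"
  shows "pH_sentence S (rename \<rho> \<phi>)"
proof -
  have m: "map snd (map (apsnd \<rho>) (prefix \<phi>)) = map \<rho> (map snd (prefix \<phi>))" by simp
  have s: "set (map snd (map (apsnd \<rho>) (prefix \<phi>))) = \<rho> ` set (map snd (prefix \<phi>))"
    unfolding m set_map ..
  have "distinct (map \<rho> (map snd (prefix \<phi>)))"
    using assms unfolding pH_sentence_def distinct_map[of \<rho>] by blast
  then show ?thesis using assms(1) unfolding pH_sentence_def rename_def sentence.simps s
    unfolding m by (auto intro: atom_ok_map_atom)
qed

lemma Pi2_witness_rename:
  assumes "inj_on \<rho> (set xs \<union> set ys)" and ok: "\<And>\<alpha>. \<alpha> \<in> C \<Longrightarrow> atom_ok S (set xs \<union> set ys) \<alpha>"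
  shows "Pi2_witness \<A> (map \<rho> xs) (map \<rho> ys) (map_atom id \<rho> ` C) t \<longleftrightarrow> Pi2_witness \<A> xs ys C t"
    (is "?L \<longleftrightarrow> ?R")
proof
  assume ?L
  then obtain e where "map e (map \<rho> xs) = t" "e ` set (map \<rho> ys) \<subseteq> univ \<A>"
    "\<forall>\<alpha>\<in>map_atom id \<rho> ` C. atom_holds \<A> e \<alpha>"
    unfolding Pi2_witness_def by blast
  then show ?R unfolding Pi2_witness_def
    by (intro exI[of _ "e \<circ> \<rho>"]) (auto simp: atom_holds_map_atom)
next
  assume ?R
  then obtain e where e: "map e xs = t" "e ` set ys \<subseteq> univ \<A>" "\<forall>\<alpha>\<in>C. atom_holds \<A> e \<alpha>"
    unfolding Pi2_witness_def by blast
  \<comment> \<open>The assignment is carried along the inverse of \<open>\<rho>\<close> on the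
    variables that occur.\<close>
  define e' where "e' = e \<circ> inv_into (set xs \<union> set ys) \<rho>"
  have e': "e' (\<rho> v) = e v" if "v \<in> set xs \<union> set ys" for v
    using assms(1) that by (simp add: e'_def inv_into_f_f)
  have "atom_holds \<A> (e' \<circ> \<rho>) \<alpha>" if "\<alpha> \<in> C" for \<alpha>
    using atom_holds_cong[OF ok[OF that], of "e' \<circ> \<rho>" e] e' e(3) that by simp
  moreover have "map e' (map \<rho> xs) = t" using e(1) e' by auto
  moreover have "e' ` set (map \<rho> ys) \<subseteq> univ \<A>" using e(2) e' by auto
  ultimately show ?L unfolding Pi2_witness_def
    by (intro exI[of _ e']) (auto simp: atom_holds_map_atom)
qed


section \<open>Canonical sentences and homomorphisms\<close>

text \<open>The record scheme admits source structures with constants. The constants are left free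
  here; their images are prescribed separately, as the values of the universal variables.\<close>

definition homomorphism ::
  "'r signature \<Rightarrow> ('r, 'd, 'z) rel_structure_scheme \<Rightarrow> ('r, 'a) rel_structure \<Rightarrow> ('d \<Rightarrow> 'a) \<Rightarrow> bool"
  where
  "homomorphism S \<D> \<A> h \<longleftrightarrow> h ` univ \<D> \<subseteq> univ \<A> \<and>
     (\<forall>R\<in>symbols S. \<forall>ds\<in>rel \<D> R. map h ds \<in> rel \<A> R)"

text \<open>Finiteness makes the conjunction and the existential block finite; distinct constants
  inside the universe ensure that the prefix binds each element exactly once.\<close>

definition finite_pointed :: "'r signature \<Rightarrow> 'c list \<Rightarrow> ('r, 'd, 'c) const_structure \<Rightarrow> bool" where
  "finite_pointed S cs \<D> \<longleftrightarrow>
     finite (symbols S) \<and> finite (univ \<D>) \<and>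
     (\<forall>R\<in>symbols S. rel \<D> R \<subseteq> tuples (univ \<D>) (arity S R)) \<and>
     distinct (map (const \<D>) cs) \<and> const \<D> ` set cs \<subseteq> univ \<D>"

lemma finite_tuples: "finite A \<Longrightarrow> finite (tuples A k)"
  using finite_lists_length_eq[of A k] by (simp add: tuples_def conj_commute)

lemma canonical_sentence_blocks:
  assumes \<D>: "finite_pointed S cs \<D>"
  obtains ys where
    "prefix (canonical_sentence S cs \<D>) = map (Pair All) (map (const \<D>) cs) @ map (Pair Ex) ys"
    and "set ys = univ \<D> - const \<D> ` set cs" and "pH_sentence S (canonical_sentence S cs \<D>)"
proof -
  define ys where "ys = (SOME ys. distinct ys \<and> set ys = univ \<D> - const \<D> ` set cs)"
  have "finite (univ \<D> - const \<D> ` set cs)" using \<D> by (simp add: finite_pointed_def)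
  \<comment> \<open>Such a list exists, so the \<open>SOME\<close> in the definition of the prefix
    meets its specification.\<close>
  then have "\<exists>ys. distinct ys \<and> set ys = univ \<D> - const \<D> ` set cs"
    by (metis finite_distinct_list)
  then have ys: "distinct ys" "set ys = univ \<D> - const \<D> ` set cs"
    unfolding ys_def by (metis (mono_tags, lifting) someI_ex)+
  have pre: "prefix (canonical_sentence S cs \<D>) =
      map (Pair All) (map (const \<D>) cs) @ map (Pair Ex) ys"
    by (simp add: canonical_sentence_def ys_def comp_def)
  have snd: "map snd (prefix (canonical_sentence S cs \<D>)) = map (const \<D>) cs @ ys"
    by (simp add: pre comp_def)
  have vars: "set (map (const \<D>) cs @ ys) = univ \<D>"
    using ys(2) \<D> by (auto simp: finite_pointed_def)
  have "conjuncts (canonical_sentence S cs \<D>)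
      \<subseteq> (\<Union>R\<in>symbols S. Rel R ` tuples (univ \<D>) (arity S R))"
    using \<D> by (auto simp: canonical_sentence_def canonical_query_def reduct_def finite_pointed_def)
  moreover have "finite (\<Union>R\<in>symbols S. Rel R ` tuples (univ \<D>) (arity S R))"
    using \<D> by (simp add: finite_pointed_def finite_tuples)
  ultimately have "finite (conjuncts (canonical_sentence S cs \<D>))"
    by (rule finite_subset)
  moreover have "atom_ok S (univ \<D>) \<alpha>" if \<alpha>: "\<alpha> \<in> conjuncts (canonical_sentence S cs \<D>)" for \<alpha>
  proof -
    obtain R ds where R: "\<alpha> = Rel R ds" "R \<in> symbols S" "ds \<in> rel \<D> R"
      using \<alpha> by (auto simp: canonical_sentence_def canonical_query_def reduct_def)
    then have "ds \<in> tuples (univ \<D>) (arity S R)" using \<D> by (auto simp: finite_pointed_def)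
    then show ?thesis using R by (simp add: tuples_def)
  qed
  moreover have "distinct (map (const \<D>) cs @ ys)"
    using ys \<D> by (auto simp: finite_pointed_def)
  ultimately have "pH_sentence S (canonical_sentence S cs \<D>)"
    unfolding pH_sentence_def snd vars by blast
  then show thesis using that pre ys(2) by blast
qed

text \<open>The variables are the elements of \<open>\<D>\<close>, so assignments satisfying the
  canonical query are homomorphisms, and the values of the universal block are the images of the
  constants. The assumption on \<open>t\<close> keeps these images in the universe.\<close>

lemma Pi2_witness_canonical_query:
  assumes \<D>: "finite_pointed S cs \<D>" and ys: "set ys = univ \<D> - const \<D> ` set cs"
    and t: "t \<in> tuples (univ \<A>) (length cs)"
  shows "Pi2_witness \<A> (map (const \<D>) cs) ys (conjuncts (canonical_sentence S cs \<D>)) t \<longleftrightarrow>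
    (\<exists>h. homomorphism S \<D> \<A> h \<and> map (\<lambda>c. h (const \<D> c)) cs = t)"
proof -
  have vars: "univ \<D> = const \<D> ` set cs \<union> set ys"
    using ys \<D> by (auto simp: finite_pointed_def)
  have "map h (map (const \<D>) cs) = t \<and> h ` set ys \<subseteq> univ \<A> \<longleftrightarrow>
      map (\<lambda>c. h (const \<D> c)) cs = t \<and> h ` univ \<D> \<subseteq> univ \<A>" for h
  proof -
    have "h ` (const \<D> ` set cs) \<subseteq> univ \<A>" if "map (\<lambda>c. h (const \<D> c)) cs = t"
      using t unfolding that[symmetric] by (auto simp: tuples_def)
    then show ?thesis unfolding vars image_Un by (auto simp: comp_def)
  qed
  moreover have "(\<forall>\<alpha>\<in>conjuncts (canonical_sentence S cs \<D>). atom_holds \<A> h \<alpha>) \<longleftrightarrow>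
      (\<forall>R\<in>symbols S. \<forall>ds\<in>rel \<D> R. map h ds \<in> rel \<A> R)" for h
    by (force simp: canonical_sentence_def canonical_query_def reduct_def)
  ultimately show ?thesis unfolding Pi2_witness_def homomorphism_def
    by (simp only: conj_assoc[symmetric]) (simp only: conj_ac)
qed

lemma models_canonical_sentence_iff:
  assumes \<D>: "finite_pointed S cs \<D>"
  shows "models \<A> (canonical_sentence S cs \<D>) \<longleftrightarrow>
    (\<forall>t\<in>tuples (univ \<A>) (length cs).
       \<exists>h. homomorphism S \<D> \<A> h \<and> map (\<lambda>c. h (const \<D> c)) cs = t)"
proof -
  obtain ys where ys:
    "prefix (canonical_sentence S cs \<D>) = map (Pair All) (map (const \<D>) cs) @ map (Pair Ex) ys"
    "set ys = univ \<D> - const \<D> ` set cs" "pH_sentence S (canonical_sentence S cs \<D>)"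
    by (rule canonical_sentence_blocks[OF \<D>])
  show ?thesis
    unfolding models_Pi2_iff[OF ys(3,1)] length_map
    by (intro ball_cong refl Pi2_witness_canonical_query[OF \<D> ys(2)])
qed

text \<open>Provides a sentence over \<open>nat\<close> to which (ii) can be applied, with its
  satisfaction on an adversary expressed by homomorphisms and its truth passing back to the
  canonical sentence.\<close>

lemma canonical_sentence_nat:
  assumes \<D>: "finite_pointed S cs \<D>" and ne: "univ \<A> \<noteq> {}"
  shows "\<exists>\<psi> :: ('r, nat) sentence. Pi2_pH_sentence S \<psi> \<and>
    length (universals (prefix \<psi>)) = length cs \<and>
    (models \<A> \<psi> \<longrightarrow> models \<A> (canonical_sentence S cs \<D>)) \<and>
    (\<forall>B\<subseteq>tuples (univ \<A>) (length cs). models_adversary \<A> \<psi> B \<longleftrightarrow>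
       (\<forall>t\<in>B. \<exists>h. homomorphism S \<D> \<A> h \<and> map (\<lambda>c. h (const \<D> c)) cs = t))"
proof -
  let ?\<phi> = "canonical_sentence S cs \<D>" and ?xs = "map (const \<D>) cs"
  obtain ys where ys: "prefix ?\<phi> = map (Pair All) ?xs @ map (Pair Ex) ys"
    "set ys = univ \<D> - const \<D> ` set cs" "pH_sentence S ?\<phi>"
    by (rule canonical_sentence_blocks[OF \<D>])
  have "finite (univ \<D>)" using \<D> by (simp add: finite_pointed_def)
  \<comment> \<open>Only finitely many elements act as variables, so they can be numbered
    injectively.\<close>
  then obtain \<rho> :: "_ \<Rightarrow> nat" where \<rho>: "inj_on \<rho> (univ \<D>)"
    by (meson finite_imp_inj_to_nat_seg)
  have vars: "set ?xs \<union> set ys = univ \<D>" using ys(2) \<D> by (auto simp: finite_pointed_def)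
  have vars': "set (map snd (prefix ?\<phi>)) = univ \<D>"
    using vars by (simp add: ys(1) image_Un image_image)
  have \<psi>: "pH_sentence S (rename \<rho> ?\<phi>)"
    by (rule pH_sentence_rename[OF ys(3)]) (use \<rho> vars' in simp)
  have pre: "prefix (rename \<rho> ?\<phi>) = map (Pair All) (map \<rho> ?xs) @ map (Pair Ex) (map \<rho> ys)"
    by (simp add: rename_def ys(1))
  have conj: "conjuncts (rename \<rho> ?\<phi>) = map_atom id \<rho> ` conjuncts ?\<phi>"
    by (simp add: rename_def)
  have wit: "Pi2_witness \<A> (map \<rho> ?xs) (map \<rho> ys) (conjuncts (rename \<rho> ?\<phi>)) t \<longleftrightarrow>
      (\<exists>h. homomorphism S \<D> \<A> h \<and> map (\<lambda>c. h (const \<D> c)) cs = t)"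
    if "t \<in> tuples (univ \<A>) (length cs)" for t
  proof -
    have "atom_ok S (set ?xs \<union> set ys) \<alpha>" if "\<alpha> \<in> conjuncts ?\<phi>" for \<alpha>
      using ys(3) that vars vars' by (simp add: pH_sentence_def)
    then show ?thesis unfolding conj Pi2_witness_canonical_query[OF \<D> ys(2) that, symmetric]
      using \<rho> vars by (intro Pi2_witness_rename) simp_all
  qed
  have "Pi2_pH_sentence S (rename \<rho> ?\<phi>)"
    using \<psi> pre unfolding Pi2_pH_sentence_def by blast
  moreover have "length (universals (prefix (rename \<rho> ?\<phi>))) = length cs"
    by (simp add: pre universals_def comp_def filter_False)
  moreover have "models \<A> (rename \<rho> ?\<phi>) \<longleftrightarrow> models \<A> ?\<phi>"
    unfolding models_Pi2_iff[OF \<psi> pre] models_canonical_sentence_iff[OF \<D>] length_map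
    by (intro ball_cong refl wit)
  moreover have "models_adversary \<A> (rename \<rho> ?\<phi>) B \<longleftrightarrow>
      (\<forall>t\<in>B. \<exists>h. homomorphism S \<D> \<A> h \<and> map (\<lambda>c. h (const \<D> c)) cs = t)"
    if "B \<subseteq> tuples (univ \<A>) (length cs)" for B
  proof -
    have "B \<subseteq> tuples (univ \<A>) (length (map \<rho> ?xs))" using that by simp
    from models_adversary_Pi2_iff[OF \<psi> pre this ne] show ?thesis
      using that by (simp only:) (intro ball_cong refl wit, blast)
  qed
  ultimately show ?thesis by blast
qed


section \<open>Homomorphisms from products and polymorphisms\<close>

text \<open>The common shape of \<open>P_structure\<close> and \<open>Q_structure\<close>: a power
  of \<open>\<A>\<close> with one factor for each \<open>X \<in> \<Omega>\<close> and
  \<open>\<mu> \<in> F X\<close>, the factors differing only in the constants given by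
  \<open>c \<mu>\<close>.\<close>

definition nested_power ::
  "'r signature \<Rightarrow> ('r, 'a) rel_structure \<Rightarrow> 'x set \<Rightarrow> ('x \<Rightarrow> 'i set) \<Rightarrow> ('i \<Rightarrow> 'c \<Rightarrow> 'a)
     \<Rightarrow> ('r, 'x \<Rightarrow> 'i \<Rightarrow> 'a, 'c) const_structure" where
  "nested_power S \<A> \<Omega> F c = product S \<Omega> (\<lambda>X. product S (F X) (\<lambda>\<mu>. expand \<A> (c \<mu>)))"

lemma univ_nested_power:
  "univ (nested_power S \<A> \<Omega> F c) = (\<Pi>\<^sub>E X\<in>\<Omega>. \<Pi>\<^sub>E \<mu>\<in>F X. univ \<A>)"
  by (simp add: nested_power_def product_def expand_def)

lemma const_nested_power:
  "const (nested_power S \<A> \<Omega> F c) x = (\<lambda>X\<in>\<Omega>. \<lambda>\<mu>\<in>F X. c \<mu> x)"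
  by (auto simp: nested_power_def product_def expand_def)

text \<open>Unfolding the two products leaves the factorwise condition; the length and universe
  conditions of the inner products follow from those of the outer one.\<close>

lemma rel_nested_power:
  "ds \<in> rel (nested_power S \<A> \<Omega> F c) R \<longleftrightarrow>
     ds \<in> tuples (univ (nested_power S \<A> \<Omega> F c)) (arity S R) \<and>
     (\<forall>X\<in>\<Omega>. \<forall>\<mu>\<in>F X. map (\<lambda>d. d X \<mu>) ds \<in> rel \<A> R)"
proof -
  have "map (\<lambda>d. d X) ds \<in> tuples (\<Pi>\<^sub>E \<mu>\<in>F X. univ \<A>) (arity S R)"
    if "ds \<in> tuples (univ (nested_power S \<A> \<Omega> F c)) (arity S R)" "X \<in> \<Omega>" for X
    using that by (auto simp: tuples_def univ_nested_power dest!: subsetD dest: PiE_mem)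
  then show ?thesis unfolding univ_nested_power
    by (auto simp: nested_power_def product_def expand_def comp_def)
qed

lemma finite_pointed_nested_power:
  assumes "finite_structure S \<A>" "finite \<Omega>" "\<And>X. X \<in> \<Omega> \<Longrightarrow> finite (F X)"
    and "\<And>X \<mu> x. X \<in> \<Omega> \<Longrightarrow> \<mu> \<in> F X \<Longrightarrow> x \<in> set cs \<Longrightarrow> c \<mu> x \<in> univ \<A>"
    and "distinct cs" "inj_on (const (nested_power S \<A> \<Omega> F c)) (set cs)"
  shows "finite_pointed S cs (nested_power S \<A> \<Omega> F c)"
  using assms unfolding finite_pointed_def
  by (auto simp: finite_structure_def univ_nested_power const_nested_power distinct_map
    rel_nested_power finite_PiE)

text \<open>Evaluation at a factor preserves all relations; \<open>f\<close> combines the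
  evaluations at the factors listed in \<open>ps\<close>, which may repeat or omit factors.\<close>

lemma homomorphism_of_polymorphism:
  assumes pol: "polymorphism S \<A> (length ps) f" and ps: "set ps \<subseteq> Sigma \<Omega> F"
  shows "homomorphism S (nested_power S \<A> \<Omega> F c) \<A> (\<lambda>d. f (map (\<lambda>(X, \<mu>). d X \<mu>) ps))"
  unfolding homomorphism_def
proof (intro conjI ballI subsetI)
  fix a assume "a \<in> (\<lambda>d. f (map (\<lambda>(X, \<mu>). d X \<mu>) ps)) ` univ (nested_power S \<A> \<Omega> F c)"
  then obtain d where d: "d \<in> (\<Pi>\<^sub>E X\<in>\<Omega>. \<Pi>\<^sub>E \<mu>\<in>F X. univ \<A>)"
    "a = f (map (\<lambda>(X, \<mu>). d X \<mu>) ps)"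
    unfolding univ_nested_power by blast
  have "d X \<mu> \<in> univ \<A>" if "(X, \<mu>) \<in> set ps" for X \<mu>
    using d(1) ps that by (blast dest: PiE_mem)
  then have "map (\<lambda>(X, \<mu>). d X \<mu>) ps \<in> tuples (univ \<A>) (length ps)"
    by (auto simp: tuples_def)
  then show "a \<in> univ \<A>" using pol d(2) by (simp add: polymorphism_def)
next
  fix R ds assume R: "R \<in> symbols S" and ds: "ds \<in> rel (nested_power S \<A> \<Omega> F c) R"
  define ts where "ts = map (\<lambda>(X, \<mu>). map (\<lambda>d. d X \<mu>) ds) ps"
  have "map (\<lambda>d. d X \<mu>) ds \<in> rel \<A> R" if "(X, \<mu>) \<in> set ps" for X \<mu>
    using ds ps that unfolding rel_nested_power by blast
  then have "ts \<in> tuples (rel \<A> R) (length ps)" by (auto simp: ts_def tuples_def)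
  then have "coordinatewise f (arity S R) ts \<in> rel \<A> R"
    using pol R by (simp add: polymorphism_def)
  moreover have "coordinatewise f (arity S R) ts = map (\<lambda>d. f (map (\<lambda>(X, \<mu>). d X \<mu>) ps)) ds"
  proof (rule nth_equalityI)
    show len: "length (coordinatewise f (arity S R) ts) = length (map (\<lambda>d. f (map (\<lambda>(X, \<mu>). d X \<mu>) ps)) ds)"
      using ds by (simp add: rel_nested_power tuples_def coordinatewise_def)
    fix i assume "i < length (coordinatewise f (arity S R) ts)"
    then have i: "i < arity S R" "i < length ds" using len by (simp_all add: coordinatewise_def)
    have "map (\<lambda>t. t ! i) ts = map (\<lambda>(X, \<mu>). (ds ! i) X \<mu>) ps"
      using i(2) by (auto simp: ts_def)
    then show "coordinatewise f (arity S R) ts ! i = map (\<lambda>d. f (map (\<lambda>(X, \<mu>). d X \<mu>) ps)) ds ! i"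
      using i by (simp add: coordinatewise_def)
  qed
  ultimately show "map (\<lambda>d. f (map (\<lambda>(X, \<mu>). d X \<mu>) ps)) ds \<in> rel \<A> R" by simp
qed

text \<open>A list of \<open>k\<close> elements of \<open>\<A>\<close>, with a position assigned to
  every factor, is an element of the power. Composing \<open>h\<close> with this packing gives a
  \<open>k\<close>-ary polymorphism.\<close>

lemma polymorphism_of_homomorphism:
  assumes \<A>: "finite_structure S \<A>" and h: "homomorphism S (nested_power S \<A> \<Omega> F c) \<A> h"
    and fin: "finite (Sigma \<Omega> F)" and ne: "Sigma \<Omega> F \<noteq> {}"
  obtains ps f where "set ps = Sigma \<Omega> F" "polymorphism S \<A> (length ps) f"
    "\<And>x. h (const (nested_power S \<A> \<Omega> F c) x) = f (map (\<lambda>(X, \<mu>). c \<mu> x) ps)"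
proof -
  let ?N = "nested_power S \<A> \<Omega> F c"
  obtain ps where ps: "set ps = Sigma \<Omega> F" using finite_list[OF fin] by blast
  define k where "k = length ps"
  \<comment> \<open>\<open>ps\<close> may contain repetitions, so one position is chosen for each
    factor; \<open>G\<close> ignores the others.\<close>
  define idx where "idx = inv_into {..<k} ((!) ps)"
  have im: "(!) ps ` {..<k} = Sigma \<Omega> F"
    unfolding k_def ps[symmetric] by (auto simp: set_conv_nth)
  have idx_lt: "idx p < k" and nth_idx: "ps ! idx p = p" if "p \<in> Sigma \<Omega> F" for p
    using inv_into_into[of p "(!) ps" "{..<k}"] f_inv_into_f[of p "(!) ps" "{..<k}"] that
    unfolding im idx_def by simp_all
  define G where "G xs = (\<lambda>X\<in>\<Omega>. \<lambda>\<mu>\<in>F X. xs ! idx (X, \<mu>))" for xs :: "'b list"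
  have G: "G xs \<in> univ ?N" if xs: "xs \<in> tuples (univ \<A>) k" for xs
  proof -
    have "xs ! idx (X, \<mu>) \<in> univ \<A>" if "X \<in> \<Omega>" "\<mu> \<in> F X" for X \<mu>
      using idx_lt[of "(X, \<mu>)"] that xs by (auto simp: tuples_def)
    then show ?thesis by (auto simp: univ_nested_power G_def)
  qed
  have "polymorphism S \<A> k (h \<circ> G)"
    unfolding polymorphism_def
  proof (intro conjI ballI)
    \<comment> \<open>There is at least one factor, so the arity is positive.\<close>
    show "1 \<le> k" using ne ps by (cases ps) (auto simp: k_def)
    show "(h \<circ> G) xs \<in> univ \<A>" if "xs \<in> tuples (univ \<A>) k" for xs
      using h G[OF that] by (auto simp: homomorphism_def)
    fix R ts assume R: "R \<in> symbols S" and ts: "ts \<in> tuples (rel \<A> R) k"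
    \<comment> \<open>Packing the columns of \<open>ts\<close> gives a tuple of the power whose
      projection to a factor is a row of \<open>ts\<close>.\<close>
    define ds where "ds = map (\<lambda>i. G (map (\<lambda>t. t ! i) ts)) [0..<arity S R]"
    have relA: "rel \<A> R \<subseteq> tuples (univ \<A>) (arity S R)"
      using \<A> R by (simp add: finite_structure_def)
    have "map (\<lambda>t. t ! i) ts \<in> tuples (univ \<A>) k" if i: "i < arity S R" for i
    proof -
      have "t ! i \<in> univ \<A>" if "t \<in> set ts" for t
      proof -
        have "t \<in> tuples (univ \<A>) (arity S R)" using that ts relA by (auto simp: tuples_def)
        then show ?thesis using i by (auto simp: tuples_def)
      qed
      then show ?thesis using ts by (auto simp: tuples_def)
    qed
    then have "ds \<in> tuples (univ ?N) (arity S R)" using G by (auto simp: ds_def tuples_def)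
    moreover have "map (\<lambda>d. d X \<mu>) ds \<in> rel \<A> R" if "X \<in> \<Omega>" "\<mu> \<in> F X" for X \<mu>
    proof -
      have lt: "idx (X, \<mu>) < length ts" using idx_lt[of "(X, \<mu>)"] that ts by (auto simp: tuples_def)
      then have mem: "ts ! idx (X, \<mu>) \<in> rel \<A> R" using ts by (auto simp: tuples_def)
      then have "length (ts ! idx (X, \<mu>)) = arity S R" using relA by (auto simp: tuples_def)
      then have "map (\<lambda>d. d X \<mu>) ds = ts ! idx (X, \<mu>)"
        using that lt by (intro nth_equalityI) (simp_all add: ds_def G_def)
      then show ?thesis using mem by simp
    qed
    ultimately have "ds \<in> rel ?N R" by (simp add: rel_nested_power)
    then have "map h ds \<in> rel \<A> R" using h R by (auto simp: homomorphism_def)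
    then show "coordinatewise (h \<circ> G) (arity S R) ts \<in> rel \<A> R"
      by (simp add: coordinatewise_def ds_def comp_def)
  qed
  \<comment> \<open>The listed values of a constant depend only on the factor, so packing them
    returns the constant even if \<open>ps\<close> repeats factors.\<close>
  moreover have "h (const ?N x) = (h \<circ> G) (map (\<lambda>(X, \<mu>). c \<mu> x) ps)" for x
  proof -
    have "map (\<lambda>(X, \<mu>). c \<mu> x) ps ! idx (X, \<mu>) = c \<mu> x" if "X \<in> \<Omega>" "\<mu> \<in> F X" for X \<mu>
      using idx_lt[of "(X, \<mu>)"] nth_idx[of "(X, \<mu>)"] that by (simp add: k_def)
    then have "G (map (\<lambda>(X, \<mu>). c \<mu> x) ps) = const ?N x"
      unfolding G_def const_nested_power by (intro restrict_ext) simp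
    then show ?thesis by simp
  qed
  ultimately show thesis using that[of ps "h \<circ> G"] ps by (simp add: k_def)
qed

text \<open>A homomorphism yields a list of all factors, but the right-hand side asks only for
  \<open>\<subseteq>\<close>, so that an explicit witness may use a few factors or just one.\<close>

lemma homomorphism_nested_power_iff:
  assumes "finite_structure S \<A>" "finite (Sigma \<Omega> F)" "Sigma \<Omega> F \<noteq> {}"
  shows "(\<exists>h. homomorphism S (nested_power S \<A> \<Omega> F c) \<A> h \<and>
      map (\<lambda>x. h (const (nested_power S \<A> \<Omega> F c) x)) cs = t) \<longleftrightarrow>
    (\<exists>ps f. set ps \<subseteq> Sigma \<Omega> F \<and> polymorphism S \<A> (length ps) f \<and>
      map (\<lambda>x. f (map (\<lambda>(X, \<mu>). c \<mu> x) ps)) cs = t)"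
    (is "?L \<longleftrightarrow> ?R")
proof
  assume ?L
  then obtain h where h: "homomorphism S (nested_power S \<A> \<Omega> F c) \<A> h"
    "map (\<lambda>x. h (const (nested_power S \<A> \<Omega> F c) x)) cs = t" by blast
  obtain ps f where ps: "set ps = Sigma \<Omega> F" "polymorphism S \<A> (length ps) f"
    and f: "\<And>x. h (const (nested_power S \<A> \<Omega> F c) x) = f (map (\<lambda>(X, \<mu>). c \<mu> x) ps)"
    by (rule polymorphism_of_homomorphism[OF assms(1) h(1) assms(2,3)]) (rule that)
  have "map (\<lambda>x. f (map (\<lambda>(X, \<mu>). c \<mu> x) ps)) cs = t" using h(2) unfolding f .
  with ps show ?R using h(2) by (intro exI[of _ ps] exI[of _ f]) simp
next
  assume ?R
  then obtain ps f where ps: "set ps \<subseteq> Sigma \<Omega> F" "polymorphism S \<A> (length ps) f"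
    "map (\<lambda>x. f (map (\<lambda>(X, \<mu>). c \<mu> x) ps)) cs = t" by blast
  have eq: "map (\<lambda>(X, \<mu>). const (nested_power S \<A> \<Omega> F c) x X \<mu>) ps = map (\<lambda>(X, \<mu>). c \<mu> x) ps" for x
    using ps(1) by (auto simp: const_nested_power)
  have "map (\<lambda>x. f (map (\<lambda>(X, \<mu>). const (nested_power S \<A> \<Omega> F c) x X \<mu>) ps)) cs = t"
    unfolding eq by (rule ps(3))
  then show ?L using homomorphism_of_polymorphism[OF ps(2,1), of c]
    by (intro exI[of _ "\<lambda>d. f (map (\<lambda>(X, \<mu>). d X \<mu>) ps)"] conjI)
qed

text \<open>Distinct elements of a product differ at some factor; in particular, non-degeneracy
  shows that there is a factor at all.\<close>

lemma nested_power_separates: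
  assumes "inj_on (const (nested_power S \<A> \<Omega> F c)) C" "x \<in> C" "y \<in> C" "x \<noteq> y"
  obtains X \<mu> where "X \<in> \<Omega>" "\<mu> \<in> F X" "c \<mu> x \<noteq> c \<mu> y"
proof -
  have "const (nested_power S \<A> \<Omega> F c) x \<noteq> const (nested_power S \<A> \<Omega> F c) y"
    using assms by (auto dest: inj_onD)
  then have "\<exists>X\<in>\<Omega>. \<exists>\<mu>\<in>F X. c \<mu> x \<noteq> c \<mu> y"
    unfolding const_nested_power by (metis (no_types, lifting) restrict_ext)
  then show thesis using that by blast
qed

section \<open>The products behind \<open>phi\<close> and \<open>phi_n\<close> as nested
  powers\<close>

lemma P_structure_eq: "P_structure S \<A> \<Omega> = nested_power S \<A> \<Omega> (\<lambda>X. X) (!)"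
  by (simp add: P_structure_def nested_power_def)

lemma Q_structure_eq:
  "Q_structure S \<A> n m \<Omega> = nested_power S \<A> \<Omega> (consistent_maps (univ \<A>) n m) (\<lambda>\<mu>. \<mu>)"
  by (simp add: Q_structure_def nested_power_def)

text \<open>A tuple that separates two constants in some member of \<open>\<Omega>\<close> also
  belongs to the union, so non-degeneracy passes to the single adversary
  \<open>\<Union>\<Omega>\<close>.\<close>

lemma P_structure_Union_inj:
  assumes "inj_on (const (P_structure S \<A> \<Omega>)) C"
  shows "inj_on (const (P_structure S \<A> {\<Union>\<Omega>})) C"
proof (rule inj_onI, rule ccontr)
  fix x y assume xy: "x \<in> C" "y \<in> C" "x \<noteq> y"
    and eq: "const (P_structure S \<A> {\<Union>\<Omega>}) x = const (P_structure S \<A> {\<Union>\<Omega>}) y"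
  obtain X t where t: "X \<in> \<Omega>" "t \<in> X" "t ! x \<noteq> t ! y"
    by (rule nested_power_separates[OF assms[unfolded P_structure_eq] xy])
  have "const (P_structure S \<A> {\<Union>\<Omega>}) z (\<Union>\<Omega>) t = t ! z" for z
    using t by (auto simp: P_structure_eq const_nested_power)
  then show False using eq t(3) by metis
qed

text \<open>The factors of the product are the tuples of \<open>\<Union>\<Omega>\<close>, so a
  homomorphism sending the constants to \<open>t\<close> is a polymorphism that takes a list of
  these tuples to \<open>t\<close>.\<close>

lemma models_phi_iff_generates:
  assumes \<A>: "finite_structure S \<A>" and \<Omega>: "\<forall>B\<in>\<Omega>. adversary (univ \<A>) m B"
    and inj: "inj_on (const (P_structure S \<A> \<Omega>)) {..<m}" and ne: "\<Union>\<Omega> \<noteq> {}"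
  shows "models \<A> (phi S \<A> m {\<Union>\<Omega>}) \<longleftrightarrow> generates S \<A> m \<Omega> (tuples (univ \<A>) m)"
proof -
  let ?N = "nested_power S \<A> {\<Union>\<Omega>} (\<lambda>X. X) (!)"
  have sub: "\<Union>\<Omega> \<subseteq> tuples (univ \<A>) m" using \<Omega> by (auto simp: adversary_def)
  have finA: "finite (univ \<A>)" using \<A> by (simp add: finite_structure_def)
  have fin: "finite (\<Union>\<Omega>)" using finite_subset[OF sub] finite_tuples[OF finA] by blast
  have fp: "finite_pointed S [0..<m] ?N"
  proof (rule finite_pointed_nested_power[OF \<A>])
    show "inj_on (const ?N) (set [0..<m])"
      using P_structure_Union_inj[OF inj] by (simp add: P_structure_eq atLeast0LessThan)
    show "t ! x \<in> univ \<A>" if "X \<in> {\<Union>\<Omega>}" "t \<in> X" "x \<in> set [0..<m]" for X t x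
      using that sub by (auto simp: tuples_def dest!: subsetD)
  qed (use fin in simp_all)
  have Sig: "finite (Sigma {\<Union>\<Omega>} (\<lambda>X. X))" "Sigma {\<Union>\<Omega>} (\<lambda>X. X) \<noteq> {}"
    using fin ne by auto
  have "(\<exists>ps f. set ps \<subseteq> Sigma {\<Union>\<Omega>} (\<lambda>X. X) \<and> polymorphism S \<A> (length ps) f \<and>
      map (\<lambda>x. f (map (\<lambda>(X, \<mu>). \<mu> ! x) ps)) [0..<m] = t) \<longleftrightarrow>
    (\<exists>k f. polymorphism S \<A> k f \<and> (\<exists>ts\<in>tuples (\<Union>\<Omega>) k. coordinatewise f m ts = t))"
    (is "?L \<longleftrightarrow> ?R") for t
  proof
    assume ?L
    then obtain ps f where ps: "set ps \<subseteq> Sigma {\<Union>\<Omega>} (\<lambda>X. X)"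
      "polymorphism S \<A> (length ps) f" "map (\<lambda>x. f (map (\<lambda>(X, \<mu>). \<mu> ! x) ps)) [0..<m] = t"
      by blast
    have "map snd ps \<in> tuples (\<Union>\<Omega>) (length ps)"
      by (auto simp: tuples_def dest!: subsetD[OF ps(1)])
    moreover have "coordinatewise f m (map snd ps) = t"
      using ps(3) by (simp add: coordinatewise_def split_def comp_def)
    ultimately show ?R using ps(2) by blast
  next
    assume ?R
    then obtain k f ts where ts: "polymorphism S \<A> k f" "ts \<in> tuples (\<Union>\<Omega>) k"
      "coordinatewise f m ts = t" by blast
    then show ?L
      by (intro exI[of _ "map (Pair (\<Union>\<Omega>)) ts"] exI[of _ f])
        (auto simp: tuples_def coordinatewise_def comp_def)
  qed
  then show ?thesis
    unfolding phi_def P_structure_eq models_canonical_sentence_iff[OF fp]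
      homomorphism_nested_power_iff[OF \<A> Sig] generates_def by simp
qed

text \<open>Position \<open>l\<close> of the list lies in block \<open>l div n\<close> at place
  \<open>l mod n\<close>; the arithmetic form links the constants with the coordinates of tuples of
  length \<open>n * m\<close>.\<close>

lemma blocks_eq:
  assumes "n > 0"
  shows "[(i, j). j \<leftarrow> [0..<m], i \<leftarrow> [0..<n]] = map (\<lambda>l. (l mod n, l div n)) [0..<n * m]"
proof (induction m)
  case (Suc m)
  have "[0..<n * Suc m] = [0..<n * m] @ [n * m..<n * m + n]"
    using upt_add_eq_append[of 0 "n * m" n] by (simp add: add.commute)
  moreover have "map (\<lambda>l. (l mod n, l div n)) [n * m..<n * m + n] = map (\<lambda>i. (i, m)) [0..<n]"
    by (rule nth_equalityI) auto
  ultimately show ?case using Suc by simp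
qed simp

lemma finite_consistent_maps: "finite A \<Longrightarrow> finite (consistent_maps A n m X)"
  unfolding consistent_maps_def
  by (rule finite_subset[of _ "{..<n} \<times> {..<m} \<rightarrow>\<^sub>E A"]) (auto intro: finite_PiE)

lemma consistent_maps_nonempty:
  assumes "\<mu> \<in> consistent_maps A n m X" "n > 0"
  shows "X \<noteq> {}"
proof -
  \<comment> \<open>The constant choice of index \<open>0\<close> in every block; it is available
    because \<open>n > 0\<close>.\<close>
  have "replicate m 0 \<in> tuples {..<n} m" using assms(2) by (auto simp: tuples_def)
  then show ?thesis using assms(1) unfolding consistent_maps_def by blast
qed

lemma finite_pointed_Q_structure:
  assumes \<A>: "finite_structure S \<A>" and fin: "finite \<Omega>" and n: "n > 0"
    and inj: "inj_on (const (Q_structure S \<A> n m \<Omega>)) ({..<n} \<times> {..<m})"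
  shows "finite_pointed S [(i, j). j \<leftarrow> [0..<m], i \<leftarrow> [0..<n]] (Q_structure S \<A> n m \<Omega>)"
  unfolding Q_structure_eq
proof (rule finite_pointed_nested_power[OF \<A> fin])
  have set: "set [(i, j). j \<leftarrow> [0..<m], i \<leftarrow> [0..<n]] = {..<n} \<times> {..<m}" by auto
  show "inj_on (const (nested_power S \<A> \<Omega> (consistent_maps (univ \<A>) n m) (\<lambda>\<mu>. \<mu>)))
      (set [(i, j). j \<leftarrow> [0..<m], i \<leftarrow> [0..<n]])"
    using inj unfolding set Q_structure_eq .
  show "\<mu> x \<in> univ \<A>" if "\<mu> \<in> consistent_maps (univ \<A>) n m X"
    "x \<in> set [(i, j). j \<leftarrow> [0..<m], i \<leftarrow> [0..<n]]" for \<mu> X x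
    using that unfolding set consistent_maps_def by (blast dest: PiE_mem)
  show "distinct [(i, j). j \<leftarrow> [0..<m], i \<leftarrow> [0..<n]]"
    unfolding blocks_eq[OF n] distinct_map
    by (auto intro!: inj_onI) (metis div_mult_mod_eq)
qed (use \<A> in \<open>simp add: finite_structure_def finite_consistent_maps\<close>)

text \<open>The unary identity. With it, evaluation at a single factor of a product becomes an
  instance of the correspondence with polymorphisms.\<close>

lemma polymorphism_hd:
  assumes "finite_structure S \<A>"
  shows "polymorphism S \<A> 1 hd"
  unfolding polymorphism_def
proof (intro conjI ballI)
  show "hd xs \<in> univ \<A>" if "xs \<in> tuples (univ \<A>) 1" for xs
    using that by (cases xs) (auto simp: tuples_def)
  fix R ts assume "R \<in> symbols S" "ts \<in> tuples (rel \<A> R) 1"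
  moreover from this obtain t where "ts = [t]" "t \<in> rel \<A> R"
    by (cases ts) (auto simp: tuples_def)
  moreover from calculation have "length t = arity S R"
    using assms by (auto simp: finite_structure_def tuples_def)
  ultimately show "coordinatewise hd (arity S R) ts \<in> rel \<A> R"
    using map_nth[of t] by (simp add: coordinatewise_def)
qed simp


section \<open>Projectivity, reactive composition and generation\<close>

lemma models_phi_n_iff:
  assumes \<A>: "finite_structure S \<A>" and fin: "finite \<Omega>" and n: "n > 0"
    and inj: "inj_on (const (Q_structure S \<A> n m \<Omega>)) ({..<n} \<times> {..<m})"
    and ne: "Sigma \<Omega> (consistent_maps (univ \<A>) n m) \<noteq> {}"
  shows "models \<A> (phi_n S \<A> n m \<Omega>) \<longleftrightarrow>
    (\<forall>t\<in>tuples (univ \<A>) (n * m). \<exists>ps f. set ps \<subseteq> Sigma \<Omega> (consistent_maps (univ \<A>) n m) \<and>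
       polymorphism S \<A> (length ps) f \<and>
       map (\<lambda>l. f (map (\<lambda>(X, \<mu>). \<mu> (l mod n, l div n)) ps)) [0..<n * m] = t)"
proof -
  have finS: "finite (Sigma \<Omega> (consistent_maps (univ \<A>) n m))"
    using \<A> fin by (simp add: finite_structure_def finite_consistent_maps)
  have len: "length [(i, j). j \<leftarrow> [0..<m], i \<leftarrow> [0..<n]] = n * m"
    by (simp add: blocks_eq[OF n])
  show ?thesis
    unfolding phi_n_def models_canonical_sentence_iff[OF finite_pointed_Q_structure[OF \<A> fin n inj]] len
    unfolding Q_structure_eq homomorphism_nested_power_iff[OF \<A> finS ne]
    unfolding blocks_eq[OF n] map_map comp_def ..
qed

text \<open>A tuple of length \<open>n * m\<close> splits into \<open>m\<close> blocks of length
  \<open>n\<close> and so is a map on pairs. Projectivity makes it consistent with an adversary of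
  \<open>\<Omega> m\<close>, and evaluation at that factor sends the constants to the tuple. Hence
  the canonical sentence holds on \<open>\<Omega> (n * m)\<close>, and (ii) applies to its version
  over \<open>nat\<close>.\<close>

lemma models_phi_n_if_Pi2:
  fixes \<Omega> :: "nat \<Rightarrow> 'a list set set" and \<A> :: "('r, 'a) rel_structure"
  assumes \<A>: "finite_structure S \<A>" and n: "card (univ \<A>) = n" "n > 0"
    and proj: "projective (univ \<A>) \<Omega>" and m: "m \<ge> 1"
    and fin: "finite (\<Omega> m)" and adv: "\<forall>B\<in>\<Omega> (n * m). adversary (univ \<A>) (n * m) B"
    and inj: "inj_on (const (Q_structure S \<A> n m (\<Omega> m))) ({..<n} \<times> {..<m})"
    and ne: "Sigma (\<Omega> m) (consistent_maps (univ \<A>) n m) \<noteq> {}"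
    and Pi2: "\<forall>\<psi> :: ('r, nat) sentence. Pi2_pH_sentence S \<psi> \<and>
      length (universals (prefix \<psi>)) = n * m \<longrightarrow>
      models_adversaries \<A> \<psi> (\<Omega> (n * m)) \<longrightarrow> models \<A> \<psi>"
  shows "models \<A> (phi_n S \<A> n m (\<Omega> m))"
proof -
  let ?Q = "Q_structure S \<A> n m (\<Omega> m)" and ?cs = "[(i, j). j \<leftarrow> [0..<m], i \<leftarrow> [0..<n]]"
  have finS: "finite (Sigma (\<Omega> m) (consistent_maps (univ \<A>) n m))"
    using \<A> fin by (simp add: finite_structure_def finite_consistent_maps)
  have len: "length ?cs = n * m" by (simp add: blocks_eq[OF n(2)])
  have hom: "\<exists>h. homomorphism S ?Q \<A> h \<and> map (\<lambda>c. h (const ?Q c)) ?cs = t"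
    if B: "B \<in> \<Omega> (n * m)" and t: "t \<in> B" for B t
  proof -
    \<comment> \<open>A single \<open>B'\<close> contains all projections of \<open>B\<close>, so it
      serves every choice of coordinates at once.\<close>
    obtain B' where B': "B' \<in> \<Omega> m" "\<forall>D\<in>Proj n m B. D \<subseteq> B'"
      using proj B m unfolding projective_def n(1) by blast
    have tt: "t \<in> tuples (univ \<A>) (n * m)" using adv B t by (auto simp: adversary_def)
    \<comment> \<open>The tuple \<open>t\<close> read as a matrix whose column \<open>j\<close> is
      its block number \<open>j\<close>.\<close>
    define \<mu> where "\<mu> = (\<lambda>(i, j)\<in>{..<n} \<times> {..<m}. t ! (j * n + i))"
    have lt: "j * n + i < n * m" if "i < n" "j < m" for i j
    proof -
      have "j * n + i < (j + 1) * n" using that by simp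
      also have "\<dots> \<le> m * n" using that by (intro mult_le_mono1) simp
      finally show ?thesis by (simp add: mult.commute)
    qed
    have "\<mu> \<in> consistent_maps (univ \<A>) n m B'"
      unfolding consistent_maps_def
    proof (intro CollectI conjI ballI)
      have "t ! (j * n + i) \<in> univ \<A>" if "i < n" "j < m" for i j
        using lt[OF that] tt by (auto simp: tuples_def)
      then show "\<mu> \<in> {..<n} \<times> {..<m} \<rightarrow>\<^sub>E univ \<A>" by (auto simp: \<mu>_def)
      fix \<iota> assume \<iota>: "\<iota> \<in> tuples {..<n} m"
      then have \<iota>_lt: "\<iota> ! j < n" if "j < m" for j
        using nth_in_tuples[OF \<iota> that] by simp
      \<comment> \<open>Picking entry \<open>\<iota> ! j\<close> from block \<open>j\<close> is one
        of the coordinate choices allowed in \<open>Proj\<close>.\<close>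
      have "(\<lambda>t. map (\<lambda>j. t ! (j * n + \<iota> ! j)) [0..<m]) ` B \<in> Proj n m B"
        unfolding Proj_def
        by (rule CollectI, rule exI[of _ "\<lambda>j. j * n + \<iota> ! j"]) (use \<iota>_lt in simp)
      from subsetD[OF bspec[OF B'(2) this] imageI[OF t]]
      have "map (\<lambda>j. t ! (j * n + \<iota> ! j)) [0..<m] \<in> B'" .
      moreover have "map (\<lambda>j. \<mu> (\<iota> ! j, j)) [0..<m] = map (\<lambda>j. t ! (j * n + \<iota> ! j)) [0..<m]"
        using \<iota>_lt by (auto simp: \<mu>_def)
      ultimately show "map (\<lambda>j. \<mu> (\<iota> ! j, j)) [0..<m] \<in> B'" by (simp only:)
    qed
    \<comment> \<open>Evaluation at the factor \<open>(B', \<mu>)\<close> alone: division with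
      remainder by \<open>n\<close> recovers the position in \<open>t\<close>.\<close>
    moreover have "map (\<lambda>l. hd (map (\<lambda>(X, \<mu>). \<mu> (l mod n, l div n)) [(B', \<mu>)])) [0..<n * m] = t"
    proof (rule nth_equalityI)
      fix l assume "l < length (map (\<lambda>l. hd (map (\<lambda>(X, \<mu>). \<mu> (l mod n, l div n)) [(B', \<mu>)])) [0..<n * m])"
      then have "l < n * m" "l mod n < n" "l div n < m"
        using n(2) by (simp_all add: less_mult_imp_div_less mult.commute)
      then show "map (\<lambda>l. hd (map (\<lambda>(X, \<mu>). \<mu> (l mod n, l div n)) [(B', \<mu>)])) [0..<n * m] ! l = t ! l"
        by (simp add: \<mu>_def)
    qed (use tt in \<open>simp add: tuples_def\<close>)
    ultimately show ?thesis
      unfolding Q_structure_eq homomorphism_nested_power_iff[OF \<A> finS ne]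
      using B'(1) polymorphism_hd[OF \<A>]
      by (intro exI[of _ "[(B', \<mu>)]"] exI[of _ hd]) (simp add: blocks_eq[OF n(2)] comp_def)
  qed
  have "univ \<A> \<noteq> {}" using \<A> by (simp add: finite_structure_def)
  from canonical_sentence_nat[OF finite_pointed_Q_structure[OF \<A> fin n(2) inj] this, unfolded len]
  obtain \<psi> :: "('r, nat) sentence" where \<psi>: "Pi2_pH_sentence S \<psi>"
    "length (universals (prefix \<psi>)) = n * m"
    "models \<A> \<psi> \<longrightarrow> models \<A> (canonical_sentence S ?cs ?Q)"
    "\<forall>B\<subseteq>tuples (univ \<A>) (n * m). models_adversary \<A> \<psi> B \<longleftrightarrow>
       (\<forall>t\<in>B. \<exists>h. homomorphism S ?Q \<A> h \<and> map (\<lambda>c. h (const ?Q c)) ?cs = t)"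
    by (elim exE conjE) (rule that)
  have "models_adversary \<A> \<psi> B" if "B \<in> \<Omega> (n * m)" for B
  proof -
    have "B \<subseteq> tuples (univ \<A>) (n * m)" using adv that by (auto simp: adversary_def)
    then show ?thesis using \<psi>(4) hom[OF that] by simp
  qed
  then have "models_adversaries \<A> \<psi> (\<Omega> (n * m))" by (simp add: models_adversaries_def)
  then have "models \<A> \<psi>" using Pi2 \<psi>(1,2) by simp
  then show ?thesis using \<psi>(3) by (simp add: phi_n_def)
qed

section \<open>From the sentences \<open>phi_n\<close> to reactive composition\<close>

lemma take_in_tuples:
  assumes "a \<in> tuples A m" "i \<le> m"
  shows "take i a \<in> tuples A i"
  using assms by (auto simp: tuples_def dest: in_set_takeD)

text \<open>Give each block of universal variables all elements of \<open>\<A>\<close> as values. In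
  every block \<open>j\<close>, the resulting \<open>f\<close> recovers the element with index
  \<open>i\<close> from the values \<open>\<mu> (i, j)\<close>, so the functions \<open>g\<close>
  only have to look up the index of their last argument.\<close>

lemma reactive_composition_if_models_phi_n:
  assumes \<A>: "finite_structure S \<A>" and card: "card (univ \<A>) = n" and fin: "finite \<Omega>" and n: "n > 0"
    and inj: "inj_on (const (Q_structure S \<A> n m \<Omega>)) ({..<n} \<times> {..<m})"
    and ne: "Sigma \<Omega> (consistent_maps (univ \<A>) n m) \<noteq> {}"
    and phi: "models \<A> (phi_n S \<A> n m \<Omega>)"
  shows "reactive_composition S \<A> m (tuples (univ \<A>) m) \<Omega>"
proof -
  have "finite (univ \<A>)" using \<A> by (simp add: finite_structure_def)
  then obtain es where es: "set es = univ \<A>" "distinct es" using finite_distinct_list by blast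
  have len: "length es = n" using distinct_card[OF es(2)] es(1) card by simp
  have "\<forall>a\<in>univ \<A>. \<exists>i<n. es ! i = a" unfolding es(1)[symmetric] len[symmetric]
    by (auto simp: set_conv_nth)
  then obtain idx where idx: "\<forall>a\<in>univ \<A>. idx a < n \<and> es ! idx a = a" using bchoice by metis
  \<comment> \<open>\<open>m\<close> copies of the enumeration \<open>es\<close>, one per
    block.\<close>
  define t where "t = map (\<lambda>l. es ! (l mod n)) [0..<n * m]"
  have "es ! (l mod n) \<in> univ \<A>" for l
    using n unfolding es(1)[symmetric] len[symmetric] by (intro nth_mem) simp
  then have "t \<in> tuples (univ \<A>) (n * m)" by (auto simp: t_def tuples_def)
  then obtain ps f where ps: "set ps \<subseteq> Sigma \<Omega> (consistent_maps (univ \<A>) n m)"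
    and f: "polymorphism S \<A> (length ps) f"
    and eq: "map (\<lambda>l. f (map (\<lambda>(X, \<mu>). \<mu> (l mod n, l div n)) ps)) [0..<n * m] = t"
    using phi unfolding models_phi_n_iff[OF \<A> fin n inj ne] by blast
  have f_w: "f (map (\<lambda>(X, \<mu>). \<mu> (i, j)) ps) = es ! i" if "i < n" "j < m" for i j
  proof -
    have "j * n + i < (j + 1) * n" using that by simp
    also have "\<dots> \<le> m * n" using that by (intro mult_le_mono1) simp
    finally have l: "j * n + i < n * m" by (simp add: mult.commute)
    have "(j * n + i) mod n = i" "(j * n + i) div n = j" using that by simp_all
    then show ?thesis using arg_cong[OF eq, of "\<lambda>t. t ! (j * n + i)"] l by (simp add: t_def)
  qed
  have \<mu>: "fst (ps ! j) \<in> \<Omega>" "snd (ps ! j) \<in> consistent_maps (univ \<A>) n m (fst (ps ! j))"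
    if "j < length ps" for j
    using nth_mem[OF that] ps by auto
  \<comment> \<open>The value depends only on the last argument \<open>xs ! i\<close>, turned into
    an index in block \<open>i\<close>; the factor \<open>ps ! j\<close> supplies the map.\<close>
  define g where "g j i xs = (if xs \<in> tuples (univ \<A>) (i + 1)
      then Some (snd (ps ! j) (idx (xs ! i), i)) else None)" for j i xs
  \<comment> \<open>An adversary is listed once for each occurrence of one of its maps in
    \<open>ps\<close>, hence possibly with repetitions.\<close>
  have "composable_via (univ \<A>) m (tuples (univ \<A>) m) f (map fst ps)"
    unfolding composable_via_def
  proof (intro exI[of _ g] conjI ballI allI impI)
    fix j i assume j: "j < length (map fst ps)" and i: "i < m"
    show "dom (g j i) \<subseteq> tuples (univ \<A>) (i + 1)" by (auto simp: g_def split: if_splits)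
    have "snd (ps ! j) (idx (xs ! i), i) \<in> univ \<A>" if "xs \<in> tuples (univ \<A>) (i + 1)" for xs
    proof -
      have "idx (xs ! i) < n" using nth_in_tuples[OF that, of i] idx by simp
      have "snd (ps ! j) \<in> {..<n} \<times> {..<m} \<rightarrow>\<^sub>E univ \<A>"
        using \<mu>(2)[of j] j by (simp add: consistent_maps_def)
      then show ?thesis by (rule PiE_mem) (use \<open>idx (xs ! i) < n\<close> i in simp)
    qed
    then show "ran (g j i) \<subseteq> univ \<A>" by (auto simp: g_def ran_def split: if_splits)
  next
    fix a assume a: "a \<in> tuples (univ \<A>) m"
    have g: "g j i (take (i + 1) a) = Some (snd (ps ! j) (idx (a ! i), i))" if "i < m" for i j
      using take_in_tuples[OF a, of "i + 1"] that by (simp add: g_def)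
    have idx_a: "idx (a ! i) < n \<and> es ! idx (a ! i) = a ! i" if "i < m" for i
      using nth_in_tuples[OF a that] idx by simp
    show "take (i + 1) a \<in> dom (g j i)" if "i < m" for i j using g[OF that] by auto
    show "map (\<lambda>i. the (g j i (take (i + 1) a))) [0..<m] \<in> map fst ps ! j"
      if j: "j < length (map fst ps)" for j
    proof -
      \<comment> \<open>The indices of the entries of \<open>a\<close> select one place per block,
        and consistency is membership in the adversary for every such selection.\<close>
      have "map idx a \<in> tuples {..<n} m" using a idx by (auto simp: tuples_def)
      then have "map (\<lambda>i. snd (ps ! j) (map idx a ! i, i)) [0..<m] \<in> fst (ps ! j)"
        using \<mu>(2)[of j] j by (auto simp: consistent_maps_def)
      moreover have "map (\<lambda>i. snd (ps ! j) (map idx a ! i, i)) [0..<m]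
          = map (\<lambda>i. the (g j i (take (i + 1) a))) [0..<m]"
        using g a by (auto simp: tuples_def)
      ultimately show ?thesis using j by simp
    qed
    show "a ! i = f (map (\<lambda>j. the (g j i (take (i + 1) a))) [0..<length (map fst ps)])"
      if "i < m" for i
    proof -
      have "map (\<lambda>j. the (g j i (take (i + 1) a))) [0..<length (map fst ps)]
          = map (\<lambda>(X, \<mu>). \<mu> (idx (a ! i), i)) ps"
        using g[OF that] by (intro nth_equalityI) (simp_all add: split_def)
      then show ?thesis using f_w[of "idx (a ! i)" i] idx_a[OF that] that by simp
    qed
  qed
  moreover have "set (map fst ps) \<subseteq> \<Omega>" using ps by auto
  ultimately show ?thesis unfolding reactive_composition_def using f
    by (intro exI[of _ "map fst ps"] exI[of _ f]) simp
qed

section \<open>Consequences of reactive composition and of generation\<close>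

lemma reactive_compositionE:
  assumes "reactive_composition S \<A> m X \<Omega>"
  obtains Bs f g where "set Bs \<subseteq> \<Omega>" "polymorphism S \<A> (length Bs) f"
    "\<And>a j i. a \<in> X \<Longrightarrow> j < length Bs \<Longrightarrow> i < m \<Longrightarrow> the (g j i (take (i + 1) a)) \<in> univ \<A>"
    "\<And>a j. a \<in> X \<Longrightarrow> j < length Bs \<Longrightarrow>
       map (\<lambda>i. the (g j i (take (i + 1) a))) [0..<m] \<in> Bs ! j"
    "\<And>a i. a \<in> X \<Longrightarrow> i < m \<Longrightarrow>
       a ! i = f (map (\<lambda>j. the (g j i (take (i + 1) a))) [0..<length Bs])"
proof -
  obtain Bs f where Bs: "set Bs \<subseteq> \<Omega>" "polymorphism S \<A> (length Bs) f"
    and "composable_via (univ \<A>) m X f Bs"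
    using assms unfolding reactive_composition_def by blast
  from this(3) show thesis unfolding composable_via_def
  proof (elim exE conjE)
    fix g :: "nat \<Rightarrow> nat \<Rightarrow> 'b list \<rightharpoonup> 'b"
    assume ran: "\<forall>j<length Bs. \<forall>i<m. dom (g j i) \<subseteq> tuples (univ \<A>) (i + 1) \<and> ran (g j i) \<subseteq> univ \<A>"
      and g: "\<forall>a\<in>X. (\<forall>j<length Bs. (\<forall>i<m. take (i + 1) a \<in> dom (g j i)) \<and>
            map (\<lambda>i. the (g j i (take (i + 1) a))) [0..<m] \<in> Bs ! j) \<and>
          (\<forall>i<m. a ! i = f (map (\<lambda>j. the (g j i (take (i + 1) a))) [0..<length Bs]))"
    show thesis
    proof (rule that[OF Bs])
      fix a j i assume a: "a \<in> X" and j: "j < length Bs" and i: "i < m"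
      have "take (i + 1) a \<in> dom (g j i)" using g a j i by blast
      then have "the (g j i (take (i + 1) a)) \<in> ran (g j i)" by (auto intro: ranI)
      then show "the (g j i (take (i + 1) a)) \<in> univ \<A>" using ran i j by blast
    next
      fix a j assume "a \<in> X" "j < length Bs"
      then show "map (\<lambda>i. the (g j i (take (i + 1) a))) [0..<m] \<in> Bs ! j" using g by simp
    next
      fix a i assume "a \<in> X" "i < m"
      then show "a ! i = f (map (\<lambda>j. the (g j i (take (i + 1) a))) [0..<length Bs])" using g by simp
    qed
  qed
qed

text \<open>For a fixed \<open>a\<close> the inner functions yield one tuple in each
  \<open>Bs ! j\<close>, and \<open>f\<close> takes these to \<open>a\<close>. Generation forgets
  that the functions work uniformly in \<open>a\<close> and see only initial segments.\<close>

lemma generates_if_reactive_composition: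
  assumes "reactive_composition S \<A> m X \<Omega>" and X: "X \<subseteq> tuples A m"
  shows "generates S \<A> m \<Omega> X"
  unfolding generates_def
proof
  fix a assume a: "a \<in> X"
  obtain Bs f g where Bs: "set Bs \<subseteq> \<Omega>" and f: "polymorphism S \<A> (length Bs) f"
    and mem: "\<And>a j. a \<in> X \<Longrightarrow> j < length Bs \<Longrightarrow>
       map (\<lambda>i. the (g j i (take (i + 1) a))) [0..<m] \<in> Bs ! j"
    and eq: "\<And>a i. a \<in> X \<Longrightarrow> i < m \<Longrightarrow>
       a ! i = f (map (\<lambda>j. the (g j i (take (i + 1) a))) [0..<length Bs])"
    by (rule reactive_compositionE[OF assms(1)]) (rule that)
  define ts where "ts = map (\<lambda>j. map (\<lambda>i. the (g j i (take (i + 1) a))) [0..<m]) [0..<length Bs]"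
  have "map (\<lambda>i. the (g j i (take (i + 1) a))) [0..<m] \<in> \<Union>\<Omega>" if "j < length Bs" for j
    by (rule UnionI[OF _ mem[OF a that]]) (use Bs nth_mem[OF that] in blast)
  then have "ts \<in> tuples (\<Union>\<Omega>) (length Bs)"
    by (auto simp: tuples_def ts_def simp del: Union_iff)
  moreover have "coordinatewise f m ts = a"
  proof (rule nth_equalityI)
    fix i assume "i < length (coordinatewise f m ts)"
    then have "i < m" by (simp add: coordinatewise_def)
    then show "coordinatewise f m ts ! i = a ! i"
      using eq[OF a, of i] by (simp add: coordinatewise_def ts_def comp_def)
  qed (use a X in \<open>auto simp: coordinatewise_def tuples_def\<close>)
  ultimately show "\<exists>k f. polymorphism S \<A> k f \<and> (\<exists>ts\<in>tuples (\<Union>\<Omega>) k. coordinatewise f m ts = a)"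
    using f by blast
qed

text \<open>Each new Skolem function transforms its arguments by the functions \<open>g\<close>,
  applies the Skolem functions for the adversaries \<open>Bs ! j\<close>, and finally
  \<open>f\<close>. This is legitimate because \<open>g\<close> uses only the values already
  played.\<close>

lemma models_if_reactive_composition:
  assumes \<A>: "finite_structure S \<A>" and \<psi>: "pH_sentence S \<psi>"
    and m: "length (universals (prefix \<psi>)) = m"
    and adv: "models_adversaries \<A> \<psi> \<Omega>"
    and react: "reactive_composition S \<A> m (tuples (univ \<A>) m) \<Omega>"
  shows "models \<A> \<psi>"
proof -
  define Q where "Q = prefix \<psi>"
  define us where "us = universals Q"
  obtain e0 where e0: "e0 \<in> univ \<A>" using \<A> by (auto simp: finite_structure_def)
  have dist: "distinct (map snd Q)" and ok: "\<And>\<alpha>. \<alpha> \<in> conjuncts \<psi> \<Longrightarrow> atom_ok S (set (map snd Q)) \<alpha>"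
    using \<psi> by (auto simp: pH_sentence_def Q_def)
  have us: "distinct us" "length us = m"
    using distinct_universals[OF dist] m by (simp_all add: us_def Q_def)
  obtain Bs f g where Bs: "set Bs \<subseteq> \<Omega>" and f: "polymorphism S \<A> (length Bs) f"
    and g: "\<And>a j i. a \<in> tuples (univ \<A>) m \<Longrightarrow> j < length Bs \<Longrightarrow> i < m \<Longrightarrow>
       the (g j i (take (i + 1) a)) \<in> univ \<A>"
    and mem: "\<And>a j. a \<in> tuples (univ \<A>) m \<Longrightarrow> j < length Bs \<Longrightarrow>
       map (\<lambda>i. the (g j i (take (i + 1) a))) [0..<m] \<in> Bs ! j"
    and eq: "\<And>a i. a \<in> tuples (univ \<A>) m \<Longrightarrow> i < m \<Longrightarrow>
       a ! i = f (map (\<lambda>j. the (g j i (take (i + 1) a))) [0..<length Bs])"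
    by (rule reactive_compositionE[OF react]) (rule that)
  define b where "b j l a = map (\<lambda>i. the (g j i (take (i + 1) a))) [0..<l]" for j l and a :: "'b list"
  \<comment> \<open>The first \<open>l\<close> transformed values depend only on the first
    \<open>l\<close> entries of \<open>a\<close>, so a Skolem function with \<open>l\<close>
    arguments can compute them.\<close>
  have b_take: "b j l (take l a) = take l (b j m a)" if "l \<le> m" for j l a
    using that by (auto simp: b_def take_map min_def)
  have "\<forall>j\<in>{..<length Bs}. models_adversary \<A> \<psi> (Bs ! j)"
    using adv Bs nth_mem by (auto simp: models_adversaries_def)
  then have "\<forall>j\<in>{..<length Bs}. \<exists>\<sigma>. (\<forall>y\<in>set (existentials Q).
             \<forall>t\<in>tuples (univ \<A>) (length (universals_before Q y)). \<sigma> y t \<in> univ \<A>) \<and>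
          (\<forall>\<pi>. map \<pi> us \<in> Bs ! j \<longrightarrow>
             (\<forall>\<alpha>\<in>conjuncts \<psi>. atom_holds \<A> (skolem_extension Q \<sigma> \<pi>) \<alpha>))"
    unfolding models_adversary_def us_def Q_def .
  then obtain \<sigma> where "\<forall>j\<in>{..<length Bs}. (\<forall>y\<in>set (existentials Q).
             \<forall>t\<in>tuples (univ \<A>) (length (universals_before Q y)). \<sigma> j y t \<in> univ \<A>) \<and>
          (\<forall>\<pi>. map \<pi> us \<in> Bs ! j \<longrightarrow>
             (\<forall>\<alpha>\<in>conjuncts \<psi>. atom_holds \<A> (skolem_extension Q (\<sigma> j) \<pi>) \<alpha>))"
    by (elim exE[OF bchoice])
  then have \<sigma>: "\<And>j y t. j < length Bs \<Longrightarrow> y \<in> set (existentials Q) \<Longrightarrow>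
        t \<in> tuples (univ \<A>) (length (universals_before Q y)) \<Longrightarrow> \<sigma> j y t \<in> univ \<A>"
    and C: "\<And>j \<pi> \<alpha>. j < length Bs \<Longrightarrow> map \<pi> us \<in> Bs ! j \<Longrightarrow> \<alpha> \<in> conjuncts \<psi> \<Longrightarrow>
        atom_holds \<A> (skolem_extension Q (\<sigma> j) \<pi>) \<alpha>"
    by simp_all
  define \<tau> where "\<tau> y t = f (map (\<lambda>j. \<sigma> j y (b j (length t) t)) [0..<length Bs])" for y t
  have "\<tau> y t \<in> univ \<A>" if y: "y \<in> set (existentials Q)"
    and t: "t \<in> tuples (univ \<A>) (length (universals_before Q y))" for y t
  proof -
    define l where "l = length (universals_before Q y)"
    have l: "l \<le> m" "length t = l"
      using length_universals_before[of Q y] m t by (simp_all add: l_def Q_def tuples_def)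
    \<comment> \<open>\<open>g\<close> is controlled only along tuples of full length, so
      \<open>t\<close> is padded with an arbitrary element.\<close>
    define a where "a = t @ replicate (m - l) e0"
    have a: "a \<in> tuples (univ \<A>) m" "take l a = t"
      using t e0 l by (auto simp: a_def tuples_def)
    have "b j l t \<in> tuples (univ \<A>) l" if "j < length Bs" for j
    proof -
      have "the (g j i (take (i + 1) t)) \<in> univ \<A>" if "i < l" for i
        using g[OF a(1) \<open>j < length Bs\<close>, of i] that l(1) unfolding a(2)[symmetric]
        by (simp add: min_def)
      then show ?thesis by (auto simp: b_def tuples_def)
    qed
    then have "map (\<lambda>j. \<sigma> j y (b j l t)) [0..<length Bs] \<in> tuples (univ \<A>) (length Bs)"
      using \<sigma>[OF _ y] by (auto simp: tuples_def l_def)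
    then show ?thesis using f l(2) by (simp add: \<tau>_def polymorphism_def)
  qed
  moreover have "atom_holds \<A> (skolem_extension Q \<tau> \<pi>) \<alpha>"
    if \<pi>: "map \<pi> us \<in> tuples (univ \<A>) m" and \<alpha>: "\<alpha> \<in> conjuncts \<psi>" for \<pi> \<alpha>
  proof -
    define a where "a = map \<pi> us"
    have a: "a \<in> tuples (univ \<A>) m" using \<pi> by (simp add: a_def)
    \<comment> \<open>For \<open>j < length Bs\<close> the assignment \<open>\<rho> j\<close> plays
      the transformed tuple, which lies in \<open>Bs ! j\<close>, against the Skolem functions for
      that adversary.\<close>
    have "\<exists>\<rho>. map \<rho> us = b j m a" for j
      using ex_map_eq[OF us(1), of "b j m a"] us(2) by (simp add: b_def)
    then obtain \<rho> where \<rho>: "\<And>j. map (\<rho> j) us = b j m a" by metis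
    have "atom_holds \<A> (skolem_extension Q (\<sigma> j) (\<rho> j)) \<alpha>" if "j < length Bs" for j
      using C[OF that _ \<alpha>] mem[OF a that] \<rho>[of j] by (simp add: b_def)
    \<comment> \<open>The new assignment is \<open>f\<close> applied to the old ones: by definition
      of \<open>\<tau>\<close> at existential variables, by reactive composition at universal
      ones.\<close>
    moreover have "skolem_extension Q \<tau> \<pi> v =
        f (map (\<lambda>j. skolem_extension Q (\<sigma> j) (\<rho> j) v) [0..<length Bs])"
      if v: "v \<in> set (map snd Q)" for v
    proof (cases "v \<in> set (existentials Q)")
      case True
      define l where "l = length (universals_before Q v)"
      have l: "l \<le> m" using length_universals_before[of Q v] m by (simp add: l_def Q_def)
      have ub: "universals_before Q v = take l us"
        unfolding l_def us_def by (rule universals_before_take)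
      have "map (\<rho> j) (universals_before Q v) = b j l (take l a)" for j
        unfolding ub b_take[OF l] using \<rho>[of j] by (simp flip: take_map)
      moreover have "map \<pi> (universals_before Q v) = take l a"
        unfolding ub a_def by (simp add: take_map)
      moreover have "length (take l a) = l" using a l by (simp add: tuples_def)
      ultimately show ?thesis using True by (simp add: skolem_extension_def \<tau>_def)
    next
      case False
      then have "v \<in> set us" using universals_or_existentials[OF v] by (simp add: us_def)
      then obtain i where i: "i < m" "us ! i = v" using us(2) by (auto simp: in_set_conv_nth)
      have "\<rho> j v = the (g j i (take (i + 1) a))" for j
        using arg_cong[OF \<rho>[of j], of "\<lambda>t. t ! i"] i us(2) by (simp add: b_def)
      moreover have "\<pi> v = a ! i" using i us(2) by (simp add: a_def)
      ultimately show ?thesis using eq[OF a i(1)] False by (simp add: skolem_extension_def)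
    qed
    ultimately show ?thesis by (rule atom_holds_polymorphism[OF f ok[OF \<alpha>]])
  qed
  ultimately have "models_adversary \<A> \<psi> (tuples (univ \<A>) m)"
    unfolding models_adversary_def Q_def[symmetric] us_def[symmetric]
    by (intro exI[of _ \<tau>]) simp
  then show ?thesis using models_if_models_adversary_tuples[OF \<psi>] m by simp
qed

text \<open>The witnesses for the generating tuples are combined by \<open>f\<close>. Since all
  universal variables come first, each \<open>t\<close> can be treated separately, so the
  polymorphism may vary with \<open>t\<close>.\<close>

lemma models_Pi2_if_generates:
  assumes \<A>: "finite_structure S \<A>" and \<psi>: "Pi2_pH_sentence S \<psi>"
    and m: "length (universals (prefix \<psi>)) = m"
    and \<Omega>: "\<forall>B\<in>\<Omega>. adversary (univ \<A>) m B" and adv: "models_adversaries \<A> \<psi> \<Omega>"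
    and gen: "generates S \<A> m \<Omega> (tuples (univ \<A>) m)"
  shows "models \<A> \<psi>"
proof -
  obtain xs ys where pH: "pH_sentence S \<psi>" and pre: "prefix \<psi> = map (Pair All) xs @ map (Pair Ex) ys"
    using \<psi> by (auto simp: Pi2_pH_sentence_def)
  have len: "length xs = m" using m by (simp add: pre universals_def comp_def filter_False)
  have ok: "atom_ok S (set xs \<union> set ys) \<alpha>" if "\<alpha> \<in> conjuncts \<psi>" for \<alpha>
    using pH that by (simp add: pH_sentence_def pre comp_def image_image)
  have wit: "Pi2_witness \<A> xs ys (conjuncts \<psi>) t" if t: "t \<in> \<Union>\<Omega>" for t
  proof -
    obtain B where B: "B \<in> \<Omega>" "t \<in> B" using t by blast
    have "B \<subseteq> tuples (univ \<A>) (length xs)" "univ \<A> \<noteq> {}"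
      using B(1) \<Omega> \<A> len by (auto simp: adversary_def finite_structure_def)
    from models_adversary_Pi2_iff[OF pH pre this] show ?thesis
      using adv B by (simp add: models_adversaries_def)
  qed
  show ?thesis unfolding models_Pi2_iff[OF pH pre] len
  proof
    fix t assume "t \<in> tuples (univ \<A>) m"
    then obtain k f ts where f: "polymorphism S \<A> k f" and ts: "ts \<in> tuples (\<Union>\<Omega>) k"
      and t: "coordinatewise f m ts = t"
      using gen unfolding generates_def by blast
    have "\<forall>s\<in>\<Union>\<Omega>. \<exists>e. map e xs = s \<and> e ` set ys \<subseteq> univ \<A> \<and> (\<forall>\<alpha>\<in>conjuncts \<psi>. atom_holds \<A> e \<alpha>)"
      using wit unfolding Pi2_witness_def by blast
    then obtain e where e: "\<forall>s\<in>\<Union>\<Omega>. map (e s) xs = s \<and> e s ` set ys \<subseteq> univ \<A> \<and>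
        (\<forall>\<alpha>\<in>conjuncts \<psi>. atom_holds \<A> (e s) \<alpha>)"
      by (elim exE[OF bchoice])
    have k: "length ts = k" and ts_mem: "\<And>j. j < k \<Longrightarrow> ts ! j \<in> \<Union>\<Omega>"
      using ts nth_mem[of _ ts] by (auto simp: tuples_def simp del: Union_iff)
    define e' where "e' v = f (map (\<lambda>j. e (ts ! j) v) [0..<k])" for v
    have "map e' xs = t"
    proof (rule nth_equalityI)
      show "length (map e' xs) = length t" using len t by (auto simp: coordinatewise_def)
      fix i assume "i < length (map e' xs)"
      then have i: "i < m" using len by simp
      have "e (ts ! j) (xs ! i) = ts ! j ! i" if "j < k" for j
      proof -
        have "map (e (ts ! j)) xs = ts ! j" using e ts_mem[OF that] by blast
        from arg_cong[OF this, of "\<lambda>t. t ! i"] show ?thesis using i len by simp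
      qed
      then have "map (\<lambda>j. e (ts ! j) (xs ! i)) [0..<k] = map (\<lambda>t. t ! i) ts"
        using k by (intro nth_equalityI) simp_all
      then show "map e' xs ! i = t ! i"
        using i len by (simp add: e'_def coordinatewise_def flip: t)
    qed
    moreover have "e' ` set ys \<subseteq> univ \<A>"
    proof
      fix a assume "a \<in> e' ` set ys"
      then obtain y where y: "y \<in> set ys" "a = e' y" by blast
      have "e (ts ! j) y \<in> univ \<A>" if "j < k" for j using e ts_mem[OF that] y(1) by blast
      then have "map (\<lambda>j. e (ts ! j) y) [0..<k] \<in> tuples (univ \<A>) k" by (auto simp: tuples_def)
      then show "a \<in> univ \<A>" using f y(2) by (simp add: e'_def polymorphism_def)
    qed
    moreover have "\<forall>\<alpha>\<in>conjuncts \<psi>. atom_holds \<A> e' \<alpha>"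
    proof
      fix \<alpha> assume \<alpha>: "\<alpha> \<in> conjuncts \<psi>"
      show "atom_holds \<A> e' \<alpha>"
      proof (rule atom_holds_polymorphism[OF f ok[OF \<alpha>]])
        show "atom_holds \<A> (e (ts ! j)) \<alpha>" if "j < k" for j
          using e ts_mem[OF that] \<alpha> by blast
      qed (simp add: e'_def)
    qed
    ultimately show "Pi2_witness \<A> xs ys (conjuncts \<psi>) t"
      unfolding Pi2_witness_def by (intro exI conjI)
  qed
qed

text \<open>(i), (ii), (iii), (v) form a cycle, (vi) lies between (v) and (ii), and (iv) is tied to
  (vi).\<close>

lemma all_equivalent_six:
  assumes "i \<Longrightarrow> ii" "ii \<Longrightarrow> iii" "iii \<Longrightarrow> v" "v \<Longrightarrow> i" "v \<Longrightarrow> vi" "vi \<Longrightarrow> ii" "iv \<longleftrightarrow> vi"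
  shows "all_equivalent [i, ii, iii, iv, v, vi]"
proof -
  have "ii = i" "iii = i" "iv = i" "v = i" "vi = i" using assms by argo+
  then show ?thesis by (simp add: all_equivalent_def)
qed

theorem theorem7:
  fixes S :: "'r signature" and \<A> :: "('r, 'a) rel_structure"
    and n :: nat and \<Omega> :: "nat \<Rightarrow> 'a list set set"
  assumes "finite_structure S \<A>"
    and "card (univ \<A>) = n"
    and "\<forall>m\<ge>1. \<forall>B\<in>\<Omega> m. adversary (univ \<A>) m B"
    and "projective (univ \<A>) \<Omega>"
    and "\<forall>m\<ge>1. \<not> degenerate S \<A> m (\<Omega> m)"
  shows "all_equivalent
    [\<forall>m\<ge>1. \<forall>\<psi> :: ('r, nat) sentence.
       pH_sentence S \<psi> \<and> length (universals (prefix \<psi>)) = m \<longrightarrow>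
       models_adversaries \<A> \<psi> (\<Omega> m) \<longrightarrow> models \<A> \<psi>,
     \<forall>m\<ge>1. \<forall>\<psi> :: ('r, nat) sentence.
       Pi2_pH_sentence S \<psi> \<and> length (universals (prefix \<psi>)) = m \<longrightarrow>
       models_adversaries \<A> \<psi> (\<Omega> m) \<longrightarrow> models \<A> \<psi>,
     \<forall>m\<ge>1. models \<A> (phi_n S \<A> n m (\<Omega> m)),
     \<forall>m\<ge>1. models \<A> (phi S \<A> m {\<Union>(\<Omega> m)}),
     \<forall>m\<ge>1. reactive_composition S \<A> m (tuples (univ \<A>) m) (\<Omega> m),
     \<forall>m\<ge>1. generates S \<A> m (\<Omega> m) (tuples (univ \<A>) m)]"
    (is "all_equivalent [?i, ?ii, ?iii, ?iv, ?v, ?vi]")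
proof -
  have finA: "finite (univ \<A>)" "univ \<A> \<noteq> {}" using assms(1) by (auto simp: finite_structure_def)
  then have n: "n > 0" using assms(2) by auto
  have injP: "inj_on (const (P_structure S \<A> (\<Omega> m))) {..<m}"
    and injQ: "inj_on (const (Q_structure S \<A> n m (\<Omega> m))) ({..<n} \<times> {..<m})" if "m \<ge> 1" for m
    using assms(2,5) that by (auto simp: degenerate_def)
  have adv: "\<forall>B\<in>\<Omega> m. adversary (univ \<A>) m B" if "m \<ge> 1" for m using assms(3) that by blast
  have fin: "finite (\<Omega> m)" if "m \<ge> 1" for m
  proof (rule finite_subset)
    show "\<Omega> m \<subseteq> Pow (tuples (univ \<A>) m)" using adv[OF that] by (auto simp: adversary_def)
  qed (use finA in \<open>simp add: finite_tuples\<close>)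
  \<comment> \<open>In a one-element structure all tuples are constant, so the constants
    \<open>0\<close> and \<open>1\<close> for \<open>m = 2\<close> would coincide.\<close>
  have "n \<noteq> 1"
  proof
    assume "n = 1"
    then obtain a where a: "univ \<A> = {a}" using assms(2) card_1_singletonE by metis
    obtain X t where "X \<in> \<Omega> 2" "t \<in> X" "t ! 0 \<noteq> t ! 1"
      by (rule nested_power_separates[OF injP[of 2, unfolded P_structure_eq], of 0 1]) auto
    moreover from this have "t \<in> tuples {a} 2" using adv[of 2] a by (auto simp: adversary_def)
    ultimately show False using nth_in_tuples[of t "{a}" 2 0] nth_in_tuples[of t "{a}" 2 1] by simp
  qed
  \<comment> \<open>As \<open>n \<ge> 2\<close>, both \<open>(0, 0)\<close> and
    \<open>(1, 0)\<close> index constants, and a factor separating them is given by a consistent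
    map.\<close>
  have Sig: "Sigma (\<Omega> m) (consistent_maps (univ \<A>) n m) \<noteq> {}" if m: "m \<ge> 1" for m
  proof -
    obtain X \<mu> where "X \<in> \<Omega> m" "\<mu> \<in> consistent_maps (univ \<A>) n m X"
      by (rule nested_power_separates[OF injQ[OF m, unfolded Q_structure_eq], of "(0, 0)" "(1, 0)"])
        (use m n \<open>n \<noteq> 1\<close> in auto)
    then show ?thesis by blast
  qed
  have "\<Union>(\<Omega> m) \<noteq> {}" if "m \<ge> 1" for m
    using Sig[OF that] consistent_maps_nonempty n by fastforce
  then have iv_vi: "?iv \<longleftrightarrow> ?vi"
    using models_phi_iff_generates[OF assms(1) adv injP] by simp
  have i_ii: "?i \<Longrightarrow> ?ii" by (simp add: Pi2_pH_sentence_def)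
  have ii_iii: ?iii if ?ii
  proof (intro allI impI)
    fix m :: nat assume m: "m \<ge> 1"
    \<comment> \<open>(ii) is used at length \<open>n * m\<close>, the length of the adversaries to
      which projectivity applies.\<close>
    then have nm: "n * m \<ge> 1" using n by simp
    show "models \<A> (phi_n S \<A> n m (\<Omega> m))"
      by (rule models_phi_n_if_Pi2[OF assms(1,2) n assms(4) m fin[OF m] adv[OF nm] injQ[OF m] Sig[OF m]])
        (use that nm in blast)
  qed
  have iii_v: "?iii \<Longrightarrow> ?v"
    using reactive_composition_if_models_phi_n[OF assms(1,2) fin n injQ Sig] by simp
  have v_i: ?i if ?v
  proof (intro allI impI, elim conjE)
    fix m :: nat and \<psi> :: "('r, nat) sentence"
    assume m: "m \<ge> 1" and "pH_sentence S \<psi>" "length (universals (prefix \<psi>)) = m"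
      and "models_adversaries \<A> \<psi> (\<Omega> m)"
    from this(2-4) show "models \<A> \<psi>"
      by (rule models_if_reactive_composition[OF assms(1)]) (rule that[rule_format, OF m])
  qed
  have v_vi: ?vi if ?v
  proof (intro allI impI)
    fix m :: nat assume m: "m \<ge> 1"
    show "generates S \<A> m (\<Omega> m) (tuples (univ \<A>) m)"
      by (rule generates_if_reactive_composition[OF that[rule_format, OF m] subset_refl])
  qed
  have vi_ii: ?ii if ?vi
  proof (intro allI impI, elim conjE)
    fix m :: nat and \<psi> :: "('r, nat) sentence"
    assume m: "m \<ge> 1" and "Pi2_pH_sentence S \<psi>" "length (universals (prefix \<psi>)) = m"
      and "models_adversaries \<A> \<psi> (\<Omega> m)"
    from this(2,3) adv[OF m] this(4) show "models \<A> \<psi>"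
      by (rule models_Pi2_if_generates[OF assms(1)]) (rule that[rule_format, OF m])
  qed
  show ?thesis by (rule all_equivalent_six[OF i_ii ii_iii iii_v v_i v_vi vi_ii iv_vi])
qed

end
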